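(* Let $\mu_0,\nu_0\in\mathcal P_2^*(\mathbb R^2)$ be template measures with $\mathcal N_{\mathrm a}[\mu_0]\neq\mathcal N_{\mathrm a}[\nu_0]$. Let $c\in(0,\tfrac12)$ and set $$\mathcal X=\left\{\mathbf A\in\mathrm{GL}(2)\ \middle|\ \frac{\sigma_{\max}(\mathbf A)-\sigma_{\min}(\mathbf A)}{\sigma_{\min}(\mathbf A)}\le\frac{c\,\lVert\mathcal N_{\mathrm a}[\mu_0]-\mathcal N_{\mathrm a}[\nu_0]\rVert_\rho}{\max\{\lVert\mathcal N[\mu_0]\rVert_{\rho\times u_{\mathbb S_1}},\lVert\mathcal N[\nu_0]\rVert_{\rho\times u_{\mathbb S_1}}\}}\right\}.$$ Consider the classes $$\mathbb F=\{\mu\in\mathcal P(\mathbb R^2)\mid\exists\,\mathbf A\in\mathcal X,\ \mathbf y\in\mathbb R^2:\ \mu=(\mathbf A\cdot+\mathbf y)_\#\mu_0\},$$ $$\mathbb G=\{\nu\in\mathcal P(\mathbb R^2)\mid\exists\,\mathbf A\in\mathcal X,\ \mathbf y\in\mathbb R^2:\ \nu=(\mathbf A\cdot+\mathbf y)_\#\nu_0\}.$$ Then any non-empty subsets $\mathbb F_0\subseteq\mathbb F$ and $\mathbb G_0\subseteq\mathbb G$ are linearly separable in mean-normalized R-CDT space, i.e. there exist a continuous linear functional $\Phi\colon L^2_\rho(\mathbb R)\to\mathbb R$ and a constant $b\in\mathbb R$ such that $$\Phi(\mathcal N_{\mathrm a}[\mu])<b<\Phi(\mathcal N_{\mathrm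 a}[\nu])\qquad\text{for all }\mu\in\mathbb F_0,\ \nu\in\mathbb G_0.$$
   Context: $\mathcal P(X)$ denotes the Borel probability measures on $X$, and $T_\#\mu=\mu\circ T^{-1}$ the push-forward. $\mathbb S_1=\{\boldsymbol\theta\in\mathbb R^2: \lVert\boldsymbol\theta\rVert=1\}$ and $u_{\mathbb S_1}=\sigma_{\mathbb S_1}/(2\pi)$ is the uniform probability measure on it ($\sigma_{\mathbb S_1}$ the arc-length measure). For $\mu\in\mathcal P(\mathbb R^2)$, $\dim(\mu)$ is the dimension of the affine hull of $\operatorname{supp}(\mu)$. $\mathcal P_2(\mathbb R^2)$ denotes the probability measures with finite second moment, and $\mathcal P_2^*(\mathbb R^2)=\{\mu\in\mathcal P_2(\mathbb R^2):\dim(\mu)>1\}$. $\sigma_{\max}(\mathbf A)$, $\sigma_{\min}(\mathbf A)$ are the largest and smallest singular values of $\mathbf A$. Restricted Radon transform: $\mathcal R_{\boldsymbol\theta}[\mu]=(S_{\boldsymbol\theta})_\#\mu\in\mathcal P(\mathbb R)$ with $S_{\boldsymbol\theta}(\mathbf x)=\langle\mathbf x,\boldsymbol\theta\rangle$. Throughout, $\rho$ is a fixed reference measure: a Borel probability measure on $\mathbb R$ with finite second moment and without atoms. For $\nu\in\mathcal P(\mathbb R)$, $F_\nu(t)=\nu((-\infty,t])$, $F_\nu^{[-1]}(t)=\inf\{s\in\mathbb R: F_\nu(s)>t\}$, and $\widehat\nu=F_\nu^{[-1]}\circ F_\rho$ (finite $\rho$-a.e.). For $\mu\in\mathcal P(\mathbb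 R^2)$, the R-CDT is $\widehat{\mathcal R}_{\boldsymbol\theta}[\mu]=\widehat{\mathcal R}[\mu](\cdot,\boldsymbol\theta)=\widehat{\nu}$ with $\nu=\mathcal R_{\boldsymbol\theta}[\mu]$. For $g\in L^2_\rho(\mathbb R)$: $\operatorname{mean}(g)=\int_{\mathbb R} g\,\mathrm d\rho$, $\operatorname{std}(g)=\bigl(\int_{\mathbb R}\lvert g-\operatorname{mean}(g)\rvert^2\,\mathrm d\rho\bigr)^{1/2}$. The normalized R-CDT is $$\mathcal N[\mu](t,\boldsymbol\theta)=\frac{\widehat{\mathcal R}_{\boldsymbol\theta}[\mu](t)-\operatorname{mean}(\widehat{\mathcal R}_{\boldsymbol\theta}[\mu])}{\operatorname{std}(\widehat{\mathcal R}_{\boldsymbol\theta}[\mu])},$$ and the mean-normalized R-CDT is $\mathcal N_{\mathrm a}[\mu](t)=\int_{\mathbb S_1}\mathcal N[\mu](t,\boldsymbol\theta)\,\mathrm du_{\mathbb S_1}(\boldsymbol\theta)$. For $\mu\in\mathcal P_2^*(\mathbb R^2)$ these are well defined with $\mathcal N[\mu]\in L^2_{\rho\times u_{\mathbb S_1}}(\mathbb R\times\mathbb S_1)$ and $\mathcal N_{\mathrm a}[\mu]\in L^2_\rho(\mathbb R)$. $\lVert\cdot\rVert_\rho$ and $\lVert\cdot\rVert_{\rho\times u_{\mathbb S_1}}$ are the norms of these $L^2$ spaces. *)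

theory Defs
  imports "HOL-Probability.Probability"
begin

definition borel_prob :: "'a::topological_space measure set" where
  "borel_prob = {\<mu>. prob_space \<mu> \<and> sets \<mu> = sets borel}"

definition msupport :: "'a::topological_space measure \<Rightarrow> 'a set" where
  "msupport \<mu> = {x. \<forall>U. open U \<and> x \<in> U \<longrightarrow> emeasure \<mu> U > 0}"

definition mdim :: "'a::euclidean_space measure \<Rightarrow> int" where
  "mdim \<mu> = aff_dim (affine hull (msupport \<mu>))"

definition borel_prob2 :: "'a::euclidean_space measure set" where
  "borel_prob2 = {\<mu> \<in> borel_prob. integrable \<mu> (\<lambda>x. (norm x)\<^sup>2)}"

definition borel_prob2_star :: "(real^2) measure set" where
  "borel_prob2_star = {\<mu> \<in> borel_prob2. mdim \<mu> > 1}"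

definition singular_values :: "real^'n^'m \<Rightarrow> real set" where
  "singular_values A = {sqrt l |l. \<exists>v. v \<noteq> 0 \<and> (transpose A ** A) *v v = l *\<^sub>R v}"

definition sigma_max :: "real^'n^'m \<Rightarrow> real" where
  "sigma_max A = Max (singular_values A)"

definition sigma_min :: "real^'n^'m \<Rightarrow> real" where
  "sigma_min A = Min (singular_values A)"

text \<open>Arc length on the unit circle is the image of Lebesgue measure under the arc-length
  parametrization; the measure lives on the circle itself, with its Borel sets as subspace.\<close>

definition arc_length_S1 :: "(real^2) measure" where
  "arc_length_S1 = distr (restrict_space lborel {0..<2 * pi})
     (restrict_space borel (sphere 0 1)) (\<lambda>t. vector [cos t, sin t])"

definition unif_S1 :: "(real^2) measure" where
  "unif_S1 = scale_measure (ennreal (1 / (2 * pi))) arc_length_S1"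

definition radon :: "(real^2) measure \<Rightarrow> real^2 \<Rightarrow> real measure" where
  "radon \<mu> \<theta> = distr \<mu> borel (\<lambda>x. x \<bullet> \<theta>)"

definition quantile :: "real measure \<Rightarrow> real \<Rightarrow> ereal" where
  "quantile \<nu> t = Inf (ereal ` {s. cdf \<nu> s > t})"

text \<open>The infimum is finite for levels strictly between 0 and 1; the conversion to the reals
  (which sends both infinities to 0) only matters where the distribution function of \<open>\<rho>\<close> is
  0 or 1, a \<open>\<rho>\<close>-null set when \<open>\<rho>\<close> has no atoms.\<close>

definition cdt :: "real measure \<Rightarrow> real measure \<Rightarrow> real \<Rightarrow> real" where
  "cdt \<rho> \<nu> t = real_of_ereal (quantile \<nu> (cdf \<rho> t))"

definition rcdt :: "real measure \<Rightarrow> (real^2) measure \<Rightarrow> real \<Rightarrow> real^2 \<Rightarrow> real" where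
  "rcdt \<rho> \<mu> t \<theta> = cdt \<rho> (radon \<mu> \<theta>) t"

definition mean :: "real measure \<Rightarrow> (real \<Rightarrow> real) \<Rightarrow> real" where
  "mean \<rho> g = (\<integral>t. g t \<partial>\<rho>)"

definition std :: "real measure \<Rightarrow> (real \<Rightarrow> real) \<Rightarrow> real" where
  "std \<rho> g = sqrt (\<integral>t. \<bar>g t - mean \<rho> g\<bar>\<^sup>2 \<partial>\<rho>)"

definition nrcdt :: "real measure \<Rightarrow> (real^2) measure \<Rightarrow> real \<Rightarrow> real^2 \<Rightarrow> real" where
  "nrcdt \<rho> \<mu> t \<theta> =
     (rcdt \<rho> \<mu> t \<theta> - mean \<rho> (\<lambda>s. rcdt \<rho> \<mu> s \<theta>)) / std \<rho> (\<lambda>s. rcdt \<rho> \<mu> s \<theta>)"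

definition mean_nrcdt :: "real measure \<Rightarrow> (real^2) measure \<Rightarrow> real \<Rightarrow> real" where
  "mean_nrcdt \<rho> \<mu> t = (\<integral>\<theta>. nrcdt \<rho> \<mu> t \<theta> \<partial>unif_S1)"

text \<open>Elements of \<open>L\<^sup>2\<close> are handled through representatives: equality of classes is equality almost
  everywhere, and the space of classes is the quotient of the following seminormed space.\<close>

definition L2_space :: "'a measure \<Rightarrow> ('a \<Rightarrow> real) set" where
  "L2_space M = {f \<in> borel_measurable M. integrable M (\<lambda>x. (f x)\<^sup>2)}"

definition L2_norm :: "'a measure \<Rightarrow> ('a \<Rightarrow> real) \<Rightarrow> real" where
  "L2_norm M f = sqrt (\<integral>x. (f x)\<^sup>2 \<partial>M)"

text \<open>Continuity with respect to the seminorm makes \<open>\<Phi>\<close> agree on functions that are equal almost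
  everywhere, so such a \<open>\<Phi>\<close> is the same thing as a continuous linear functional on the quotient.
  The values of \<open>\<Phi>\<close> outside \<open>L2_space M\<close> are irrelevant.\<close>

definition continuous_linear_functional_L2 :: "'a measure \<Rightarrow> (('a \<Rightarrow> real) \<Rightarrow> real) \<Rightarrow> bool" where
  "continuous_linear_functional_L2 M \<Phi> \<longleftrightarrow>
     (\<forall>f\<in>L2_space M. \<forall>g\<in>L2_space M. \<Phi> (\<lambda>x. f x + g x) = \<Phi> f + \<Phi> g) \<and>
     (\<forall>a. \<forall>f\<in>L2_space M. \<Phi> (\<lambda>x. a * f x) = a * \<Phi> f) \<and>
     (\<forall>f\<in>L2_space M. \<forall>e>0. \<exists>d>0. \<forall>g\<in>L2_space M.
        L2_norm M (\<lambda>x. g x - f x) < d \<longrightarrow> \<bar>\<Phi> g - \<Phi> f\<bar> < e)"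

definition affine_class :: "(real^2^2) set \<Rightarrow> (real^2) measure \<Rightarrow> (real^2) measure set" where
  "affine_class X \<mu>\<^sub>0 =
     {\<mu> \<in> borel_prob. \<exists>A\<in>X. \<exists>y. \<mu> = distr \<mu>\<^sub>0 borel (\<lambda>x. A *v x + y)}"

end

theory Submission
  imports Defs
begin

text \<open>Fix a template \<open>\<mu>\<close> and let \<open>\<mu>'\<close> be its image under \<open>x \<mapsto> A x + y\<close>. Projecting \<open>\<mu>'\<close> in the direction
  \<open>\<theta>\<close> gives an increasing affine image of the projection of \<open>\<mu>\<close> in the direction \<open>h \<theta>\<close>, where \<open>h \<theta>\<close>
  is the normalized vector \<open>A\<^sup>T \<theta>\<close>. Quantile functions follow increasing affine maps and
  standardization removes them, so the normalized transform of \<open>\<mu>'\<close> at \<open>(t, \<theta>)\<close> is that of \<open>\<mu>\<close> at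
  \<open>(t, h \<theta>)\<close>, for almost every \<open>t\<close> and all \<open>\<theta>\<close> (lemma \<open>nrcdt_affine\<close>).

  The mean-normalized transform of \<open>\<mu>'\<close> is therefore the integral of the normalized transform of \<open>\<mu>\<close>
  against the image of the uniform measure \<open>u\<close> under \<open>h\<close>. That image and \<open>u\<close> bound each other up to the
  factor \<open>\<sigma>\<^sub>m\<^sub>a\<^sub>x / \<sigma>\<^sub>m\<^sub>i\<^sub>n\<close> (lemma \<open>direction_map_distortion\<close>): up to a constant, \<open>u\<close> measures a set of
  directions by the area of the sector it spans in the unit disc (lemma \<open>unif_S1_sector\<close>), a linear
  map multiplies areas by \<open>\<bar>det A\<bar> = \<sigma>\<^sub>m\<^sub>i\<^sub>n \<sigma>\<^sub>m\<^sub>a\<^sub>x\<close>, and it maps the unit disc to a set between the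
  discs of radius \<open>\<sigma>\<^sub>m\<^sub>i\<^sub>n\<close> and \<open>\<sigma>\<^sub>m\<^sub>a\<^sub>x\<close>. With Jensen's inequality and Fubini's theorem, the
  mean-normalized transforms of \<open>\<mu>\<close> and \<open>\<mu>'\<close> differ in norm by at most \<open>(\<sigma>\<^sub>m\<^sub>a\<^sub>x - \<sigma>\<^sub>m\<^sub>i\<^sub>n) / \<sigma>\<^sub>m\<^sub>i\<^sub>n\<close> times
  the norm of the normalized transform of \<open>\<mu>\<close> (lemma \<open>mean_nrcdt_affine_distance\<close>).

  Let \<open>m\<close> and \<open>n\<close> be the mean-normalized transforms of the two templates and \<open>D\<close> the norm of their
  difference. All transforms of one class lie within \<open>c D\<close> of \<open>m\<close>, those of the other within \<open>c D\<close> of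
  \<open>n\<close>. The inner product with \<open>n - m\<close> moves by \<open>D\<^sup>2\<close> from \<open>m\<close> to \<open>n\<close> and by at most \<open>c D\<^sup>2 < D\<^sup>2 / 2\<close>
  inside each class, so its value in the middle between \<open>m\<close> and \<open>n\<close> separates the classes.\<close>

section \<open>Planar sectors under linear maps\<close>

text \<open>The part of the closed unit disc, without its centre, that lies in the directions of \<open>E\<close>. Only the
  unit vectors in \<open>E\<close> matter, so \<open>E\<close> may be any set of vectors.\<close>

definition sector :: "(real^2) set \<Rightarrow> (real^2) set" where
  "sector E = {x. x \<noteq> 0 \<and> norm x \<le> 1 \<and> sgn x \<in> E}"

lemma borel_measurable_sgn_vector [measurable (raw)]:
  fixes f :: "'a \<Rightarrow> 'b :: {real_normed_vector, second_countable_topology}"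
  assumes [measurable]: "f \<in> borel_measurable M"
  shows "(\<lambda>x. sgn (f x)) \<in> borel_measurable M"
  unfolding sgn_div_norm by measurable

lemma sector_borel:
  assumes "E \<in> sets borel"
  shows "sector E \<in> sets borel"
proof -
  have "sector E = (sgn -` E \<inter> space borel) \<inter> cball 0 1 - {0}"
    by (auto simp: sector_def)
  also have "\<dots> \<in> sets borel"
    using measurable_sets[OF borel_measurable_sgn_vector[OF measurable_ident] assms] by auto
  finally show ?thesis .
qed

lemma sector_lmeasurable: "E \<in> sets borel \<Longrightarrow> sector E \<in> lmeasurable"
  using sector_borel[of E]
  by (intro bounded_set_imp_lmeasurable) (auto simp: bounded_iff sector_def)

lemma sgn_matrix_vector_sgn:
  fixes B :: "real^2^2"
  shows "sgn (B *v sgn x) = sgn (B *v x)"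
proof (cases "x = 0")
  case False
  then show ?thesis
    by (simp add: sgn_div_norm[of x] matrix_vector_mult_scaleR sgn_scaleR)
qed simp

lemma borel_measurable_matrix_vector [measurable]:
  fixes B :: "real^'n^'m"
  shows "(\<lambda>x. B *v x) \<in> borel_measurable borel"
  by (intro borel_measurable_continuous_onI matrix_vector_mult_linear_continuous_on)

text \<open>The directions that \<open>B\<close> sends into \<open>E\<close> cut a set \<open>W\<close> out of the disc. Its image under \<open>B\<close> lies in the
  cone over \<open>E\<close>, contains every nonzero vector of that cone of length at most \<open>a\<close>, and contains none longer
  than \<open>b\<close>. Hence it lies between two scaled copies of \<open>sector E\<close>, while its area is \<open>\<bar>det B\<bar>\<close> times
  the area of \<open>W\<close>.\<close>

lemma measure_sector_preimage:
  fixes B :: "real^2^2"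
  assumes E: "E \<in> sets borel" and a: "0 < a"
    and lower: "\<And>x. a * norm x \<le> norm (B *v x)"
    and upper: "\<And>x. norm (B *v x) \<le> b * norm x"
  shows "a\<^sup>2 * measure lebesgue (sector E)
           \<le> \<bar>det B\<bar> * measure lebesgue (sector {\<theta>. sgn (B *v \<theta>) \<in> E})"
    and "\<bar>det B\<bar> * measure lebesgue (sector {\<theta>. sgn (B *v \<theta>) \<in> E})
           \<le> b\<^sup>2 * measure lebesgue (sector E)"
proof -
  define W where "W = sector {\<theta>. sgn (B *v \<theta>) \<in> E}"
  have W_eq: "W = {x. x \<noteq> 0 \<and> norm x \<le> 1 \<and> sgn (B *v x) \<in> E}"
    by (auto simp: W_def sector_def sgn_matrix_vector_sgn)
  have "{\<theta>. sgn (B *v \<theta>) \<in> E} \<in> sets borel"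
    using E by measurable
  then have W: "W \<in> lmeasurable"
    unfolding W_def by (rule sector_lmeasurable)
  have nz: "B *v x \<noteq> 0" if "x \<noteq> 0" for x
    using lower[of x] that a by (metis mult_pos_pos norm_zero not_le zero_less_norm_iff)
  then have "invertible B"
    using matrix_left_invertible_ker[of B] invertible_left_inverse[of B] by metis
  then have surj: "\<exists>x. B *v x = y" for y
    by (metis invertible_right_inverse matrix_vector_mul_assoc matrix_vector_mul_lid)
  have image: "measure lebesgue ((*v) B ` W) = \<bar>det B\<bar> * measure lebesgue W"
    "((*v) B ` W) \<in> lmeasurable"
    using measure_linear_image[OF matrix_vector_mul_linear W, of B]
      measurable_linear_image[OF matrix_vector_mul_linear W, of B] by auto
  have scale: "measure lebesgue ((*\<^sub>R) r ` sector E) = r\<^sup>2 * measure lebesgue (sector E)"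
    "(*\<^sub>R) r ` sector E \<in> lmeasurable" for r :: real
    using measure_lebesgue_affine[of r 0 "sector E"] sector_lmeasurable[OF E]
    by (auto intro: measurable_linear_image)
  have b: "0 < b"
  proof -
    have "a * 1 \<le> b * 1"
      using order_trans[OF lower[of "axis 1 1"] upper[of "axis 1 1"]] unfolding norm_axis_1 .
    then show ?thesis using a by simp
  qed
  have "(*v) B ` W \<subseteq> (*\<^sub>R) b ` sector E"
  proof
    fix y assume "y \<in> (*v) B ` W"
    then obtain x where x: "x \<in> W" "y = B *v x" by auto
    then have "x \<noteq> 0" "norm x \<le> 1" "sgn y \<in> E" by (auto simp: W_eq)
    moreover have "norm y \<le> b"
      using order_trans[OF upper[of x] mult_left_le[of "norm x" b]] x(2) b \<open>norm x \<le> 1\<close> by simp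
    ultimately have "inverse b *\<^sub>R y \<in> sector E"
      using nz[of x] b x by (simp add: sector_def sgn_scaleR divide_simps)
    then show "y \<in> (*\<^sub>R) b ` sector E"
      using b by (intro image_eqI[of _ _ "inverse b *\<^sub>R y"]) auto
  qed
  then have "measure lebesgue ((*v) B ` W) \<le> measure lebesgue ((*\<^sub>R) b ` sector E)"
    using image(2) scale(2) by (intro measure_mono_fmeasurable fmeasurableD)
  then show "\<bar>det B\<bar> * measure lebesgue (sector {\<theta>. sgn (B *v \<theta>) \<in> E})
           \<le> b\<^sup>2 * measure lebesgue (sector E)"
    unfolding image(1) scale(1) unfolding W_def .
  have "(*\<^sub>R) a ` sector E \<subseteq> (*v) B ` W"
  proof
    fix y assume "y \<in> (*\<^sub>R) a ` sector E"
    then obtain z where z: "z \<in> sector E" "y = a *\<^sub>R z" by auto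
    obtain x where x: "B *v x = y" using surj by blast
    have "a * norm x \<le> a * norm z"
      using lower[of x] x z a by simp
    then have "x \<in> W"
      using z a x by (auto simp: W_eq sector_def sgn_scaleR)
    then show "y \<in> (*v) B ` W" using x by auto
  qed
  then have "measure lebesgue ((*\<^sub>R) a ` sector E) \<le> measure lebesgue ((*v) B ` W)"
    using image(2) scale(2) by (intro measure_mono_fmeasurable fmeasurableD)
  then show "a\<^sup>2 * measure lebesgue (sector E)
           \<le> \<bar>det B\<bar> * measure lebesgue (sector {\<theta>. sgn (B *v \<theta>) \<in> E})"
    unfolding image(1) scale(1) unfolding W_def .
qed

section \<open>Singular values of planar matrices\<close>

text \<open>The hypotheses say that the symmetric matrix with rows \<open>(p, q)\<close> and \<open>(q, s)\<close> has trace \<open>l + L\<close> and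
  determinant \<open>l * L\<close>, that is, eigenvalues \<open>l\<close> and \<open>L\<close>.\<close>

lemma quadratic_form_between_eigenvalues:
  fixes p q s l L y z :: real
  assumes "l \<le> L" and ps: "p + s = l + L" "p * s - q\<^sup>2 = l * L"
  shows "l * (y\<^sup>2 + z\<^sup>2) \<le> p * y\<^sup>2 + 2 * q * (y * z) + s * z\<^sup>2"
    and "p * y\<^sup>2 + 2 * q * (y * z) + s * z\<^sup>2 \<le> L * (y\<^sup>2 + z\<^sup>2)"
proof -
  have psd: "0 \<le> u * y\<^sup>2 + 2 * v * (y * z) + w * z\<^sup>2"
    if "0 \<le> u" "0 \<le> w" "u * w = v\<^sup>2" for u v w :: real
  proof (cases "u = 0")
    case False
    \<comment> \<open>Completing the square.\<close>
    have "u * (u * y\<^sup>2 + 2 * v * (y * z) + w * z\<^sup>2) = (u * y + v * z)\<^sup>2"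
      using that(3) by algebra
    then have "0 \<le> u * (u * y\<^sup>2 + 2 * v * (y * z) + w * z\<^sup>2)" by simp
    then show ?thesis using False that(1) by (simp add: zero_le_mult_iff)
  qed (use that in simp)
  have sq: "(L - p) * (L - s) = q\<^sup>2" "(p - l) * (s - l) = q\<^sup>2"
    using ps by algebra+
  have "s - l = L - p" using ps by simp
  then have "0 \<le> (p - l) * (L - p)"
    using sq(2) zero_le_power2[of q] by simp
  then have "l \<le> p \<and> p \<le> L"
    using \<open>l \<le> L\<close> by (auto simp: zero_le_mult_iff)
  then have bounds: "l \<le> p" "p \<le> L" "l \<le> s" "s \<le> L" using ps by auto
  show "p * y\<^sup>2 + 2 * q * (y * z) + s * z\<^sup>2 \<le> L * (y\<^sup>2 + z\<^sup>2)"
    using psd[of "L - p" "L - s" "- q"] bounds sq by (simp add: algebra_simps)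
  show "l * (y\<^sup>2 + z\<^sup>2) \<le> p * y\<^sup>2 + 2 * q * (y * z) + s * z\<^sup>2"
    using psd[of "p - l" "s - l" "q"] bounds sq by (simp add: algebra_simps)
qed

text \<open>The bounds are stated for the transpose, which is the map that acts on the directions of a Radon
  transform. They hold because \<open>transpose A ** A\<close> and \<open>A ** transpose A\<close> have the same trace and
  determinant, hence the same eigenvalues.\<close>

lemma planar_singular_values:
  fixes A :: "real^2^2"
  assumes "invertible A"
  shows "0 < sigma_min A" "sigma_min A \<le> sigma_max A"
    "sigma_min A * sigma_max A = \<bar>det A\<bar>"
    "sigma_min A * norm x \<le> norm (transpose A *v x)"
    "norm (transpose A *v x) \<le> sigma_max A * norm x"
proof -
  \<comment> \<open>\<open>T\<close> and \<open>(det A)\<^sup>2\<close> are the trace and determinant of \<open>transpose A ** A\<close>; \<open>l\<close> and \<open>L\<close> are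
    its eigenvalues.\<close>
  define T where "T = (A$1$1)\<^sup>2 + (A$1$2)\<^sup>2 + (A$2$1)\<^sup>2 + (A$2$2)\<^sup>2"
  define D where "D = sqrt (T\<^sup>2 - 4 * (det A)\<^sup>2)"
  define l where "l = (T - D) / 2"
  define L where "L = (T + D) / 2"
  have T2: "T\<^sup>2 - 4 * (det A)\<^sup>2 =
      ((A$1$1)\<^sup>2 + (A$1$2)\<^sup>2 - (A$2$1)\<^sup>2 - (A$2$2)\<^sup>2)\<^sup>2 + 4 * (A$1$1 * A$2$1 + A$1$2 * A$2$2)\<^sup>2"
    unfolding T_def det_2 by algebra
  then have disc: "0 \<le> T\<^sup>2 - 4 * (det A)\<^sup>2" by simp
  then have D2: "D\<^sup>2 = T\<^sup>2 - 4 * (det A)\<^sup>2" and D0: "0 \<le> D"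
    by (auto simp: D_def)
  have d: "det A \<noteq> 0" using assms by (simp add: invertible_det_nz)
  have lL: "l * L = (det A)\<^sup>2" "l + L = T"
    using D2 by (auto simp: l_def L_def field_simps power2_eq_square)
  have "0 \<le> T" by (simp add: T_def)
  then have "0 < l"
  proof -
    have "0 < l * L" using lL d by simp
    moreover have "0 \<le> L" using \<open>0 \<le> T\<close> D0 by (simp add: L_def)
    ultimately show ?thesis by (simp add: zero_less_mult_iff)
  qed
  have "l \<le> L" using D0 by (simp add: l_def L_def)
  have eigen: "(\<exists>v. v \<noteq> 0 \<and> (transpose A ** A) *v v = k *\<^sub>R v) \<longleftrightarrow> k = l \<or> k = L" for k
  proof -
    have scale: "mat k *v v = k *\<^sub>R v" for v :: "real^2"
    proof -
      have "(\<Sum>j\<in>UNIV. (if i = j then k else 0) * v $ j)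
          = (\<Sum>j\<in>UNIV. if i = j then k * v $ j else 0)" for i
        by (rule sum.cong) simp_all
      then show ?thesis by (simp add: vec_eq_iff matrix_vector_mult_def mat_def)
    qed
    have "(\<exists>v. v \<noteq> 0 \<and> (transpose A ** A) *v v = k *\<^sub>R v)
        \<longleftrightarrow> (\<exists>v. v \<noteq> 0 \<and> (transpose A ** A - mat k) *v v = 0)"
      by (simp add: matrix_vector_mult_diff_rdistrib scale del: matrix_vector_mul_assoc)
    also have "\<dots> \<longleftrightarrow> det (transpose A ** A - mat k) = 0"
      using matrix_left_invertible_ker[of "transpose A ** A - mat k"]
        invertible_left_inverse[of "transpose A ** A - mat k"]
        invertible_det_nz[of "transpose A ** A - mat k"] by auto
    also have "det (transpose A ** A - mat k) = (k - l) * (k - L)"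
    proof -
      have "det (transpose A ** A - mat k) = k\<^sup>2 - T * k + (det A)\<^sup>2"
        unfolding det_2 T_def
        by (simp add: matrix_matrix_mult_def transpose_def mat_def sum_2) algebra
      also have "\<dots> = (k - l) * (k - L)"
        unfolding lL[symmetric] by (simp add: power2_eq_square algebra_simps)
      finally show ?thesis .
    qed
    finally show ?thesis by auto
  qed
  have "singular_values A = {sqrt l, sqrt L}"
    unfolding singular_values_def eigen by auto
  then have min: "sigma_min A = sqrt l" and max: "sigma_max A = sqrt L"
    using \<open>l \<le> L\<close> by (auto simp: sigma_min_def sigma_max_def min_def max_def)
  show "0 < sigma_min A" "sigma_min A \<le> sigma_max A" "sigma_min A * sigma_max A = \<bar>det A\<bar>"
    using \<open>0 < l\<close> \<open>l \<le> L\<close> lL by (auto simp: min max real_sqrt_mult[symmetric])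
  \<comment> \<open>The entries of \<open>A ** transpose A\<close>.\<close>
  define p where "p = (A$1$1)\<^sup>2 + (A$1$2)\<^sup>2"
  define q where "q = A$1$1 * A$2$1 + A$1$2 * A$2$2"
  define s where "s = (A$2$1)\<^sup>2 + (A$2$2)\<^sup>2"
  have ps: "p + s = l + L" "p * s - q\<^sup>2 = l * L"
    unfolding lL by (simp_all add: p_def q_def s_def T_def det_2 power2_eq_square algebra_simps)
  have form: "(norm (transpose A *v x))\<^sup>2 = p * (x$1)\<^sup>2 + 2 * q * (x$1 * x$2) + s * (x$2)\<^sup>2"
    unfolding power2_norm_eq_inner
    by (simp add: inner_vec_def sum_2 matrix_vector_mult_def transpose_def p_def q_def s_def)
      algebra
  have nx: "(norm x)\<^sup>2 = (x$1)\<^sup>2 + (x$2)\<^sup>2"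
    unfolding power2_norm_eq_inner by (simp add: inner_vec_def sum_2 power2_eq_square)
  note bounds = quadratic_form_between_eigenvalues[OF \<open>l \<le> L\<close> ps, of "x$1" "x$2", folded form nx]
  have "(norm (transpose A *v x))\<^sup>2 \<le> (sigma_max A * norm x)\<^sup>2"
    using bounds(2) \<open>0 < l\<close> \<open>l \<le> L\<close> by (simp add: max power_mult_distrib)
  then show "norm (transpose A *v x) \<le> sigma_max A * norm x"
    by (rule power2_le_imp_le) (use \<open>0 < l\<close> \<open>l \<le> L\<close> in \<open>simp add: max\<close>)
  have "(sigma_min A * norm x)\<^sup>2 \<le> (norm (transpose A *v x))\<^sup>2"
    using bounds(1) \<open>0 < l\<close> by (simp add: min power_mult_distrib)
  then show "sigma_min A * norm x \<le> norm (transpose A *v x)"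
    by (rule power2_le_imp_le) simp
qed

section \<open>The uniform measure on the circle\<close>

text \<open>The unit circle with its Borel sets, the measurable space that carries \<open>unif_S1\<close>.\<close>

abbreviation S1 :: "(real^2) measure" where
  "S1 \<equiv> restrict_space borel (sphere 0 1)"

text \<open>The point of the unit circle at angle \<open>t\<close>.\<close>

definition unit_vec :: "real \<Rightarrow> real^2" where
  "unit_vec t = vector [cos t, sin t]"

text \<open>The counterclockwise rotation of the plane by the angle \<open>s\<close>.\<close>

definition rotation :: "real \<Rightarrow> real^2^2" where
  "rotation s = vector [vector [cos s, - sin s], vector [sin s, cos s]]"

lemma unit_vec_conv: "unit_vec t = cos t *\<^sub>R axis 1 1 + sin t *\<^sub>R axis 2 1"
  unfolding vec_eq_iff forall_2 by (simp add: unit_vec_def axis_def)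

lemma unit_vec_periodic: "unit_vec (t + 2 * pi) = unit_vec t"
  by (simp add: unit_vec_def)

lemma norm_unit_vec [simp]: "norm (unit_vec t) = 1"
  by (simp add: norm_eq_1 unit_vec_def inner_vec_def sum_2 flip: power2_eq_square)

lemma unit_vec_measurable [measurable]: "unit_vec \<in> borel_measurable borel"
  unfolding unit_vec_conv[abs_def] by measurable

lemma sphere_unit_vec:
  assumes "norm (x :: real^2) = 1"
  obtains t where "0 \<le> t" "t < 2 * pi" "x = unit_vec t"
proof -
  have "(x$1)\<^sup>2 + (x$2)\<^sup>2 = 1"
    using assms by (simp add: norm_eq_1 inner_vec_def sum_2 power2_eq_square)
  then obtain t where "0 \<le> t" "t < 2 * pi" "x$1 = cos t" "x$2 = sin t"
    using sincos_total_2pi by metis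
  then show ?thesis
    by (intro that[of t]) (simp_all add: unit_vec_def vec_eq_iff forall_2)
qed

text \<open>This form separates the dependence on the angle from the dependence on the vector, which gives
  joint measurability below.\<close>

lemma rotation_mult: "rotation s *v x = cos s *\<^sub>R x + sin s *\<^sub>R (rotation (pi / 2) *v x)"
  unfolding vec_eq_iff forall_2
  by (simp add: rotation_def matrix_vector_mult_def sum_2)

lemma rotation_unit_vec: "rotation s *v unit_vec t = unit_vec (s + t)"
  unfolding vec_eq_iff forall_2
  by (simp add: rotation_def unit_vec_def matrix_vector_mult_def sum_2 cos_add sin_add)

lemma det_rotation: "det (rotation s) = 1"
  by (simp add: det_2 rotation_def flip: power2_eq_square)

lemma norm_rotation: "norm (rotation s *v x) = norm x"
proof (cases "x = 0")
  case False
  then obtain t where t: "sgn x = unit_vec t"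
    using sphere_unit_vec[of "sgn x"] by (auto simp: norm_sgn)
  have x: "x = norm x *\<^sub>R sgn x" using False by (simp add: sgn_div_norm)
  have "rotation s *v x = norm x *\<^sub>R unit_vec (s + t)"
    by (subst x) (simp add: matrix_vector_mult_scaleR t rotation_unit_vec)
  then show ?thesis by simp
qed simp

lemma rotation_measurable [measurable]:
  "(\<lambda>(s, x). rotation s *v x) \<in> borel_measurable (borel \<Otimes>\<^sub>M borel)"
proof -
  have "(\<lambda>(s, x). rotation s *v x)
      = (\<lambda>(s, x). cos s *\<^sub>R x + sin s *\<^sub>R (rotation (pi / 2) *v x))"
    by (intro ext) (clarify, rule rotation_mult)
  then show ?thesis by simp
qed

lemma sets_unif_S1 [measurable_cong]: "sets unif_S1 = sets S1"
  by (simp add: unif_S1_def arc_length_S1_def)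

lemma space_unif_S1: "space unif_S1 = sphere 0 1"
  using sets_eq_imp_space_eq[OF sets_unif_S1] by (simp add: space_restrict_space)

lemma sets_S1_iff: "E \<in> sets S1 \<longleftrightarrow> E \<in> sets borel \<and> E \<subseteq> sphere 0 1"
  by (subst sets_restrict_space_iff) auto

lemma nn_integral_unif_S1:
  assumes [measurable]: "f \<in> borel_measurable S1"
  shows "(\<integral>\<^sup>+\<theta>. f \<theta> \<partial>unif_S1)
    = ennreal (1 / (2 * pi)) * (\<integral>\<^sup>+t. f (unit_vec t) * indicator {0..<2 * pi} t \<partial>lborel)"
proof -
  have [measurable]: "unit_vec \<in> restrict_space lborel {0..<2 * pi} \<rightarrow>\<^sub>M S1"
    by (intro measurable_restrict_space2 measurable_restrict_space1) auto
  have "arc_length_S1 = distr (restrict_space lborel {0..<2 * pi}) S1 unit_vec"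
    by (simp add: arc_length_S1_def unit_vec_def[abs_def])
  then have unif: "unif_S1 = scale_measure (ennreal (1 / (2 * pi)))
      (distr (restrict_space lborel {0..<2 * pi}) S1 unit_vec)"
    by (simp add: unif_S1_def)
  show ?thesis
    unfolding unif
    by (subst nn_integral_scale_measure)
      (simp_all add: nn_integral_distr nn_integral_restrict_space)
qed

lemma emeasure_unif_S1:
  assumes "E \<in> sets S1"
  shows "emeasure unif_S1 E = ennreal (1 / (2 * pi)) *
    (\<integral>\<^sup>+t. indicator E (unit_vec t) * indicator {0..<2 * pi} t \<partial>lborel)"
  using assms nn_integral_unif_S1[of "indicator E"]
  by (simp add: nn_integral_indicator sets_unif_S1)

lemma prob_space_unif_S1: "prob_space unif_S1"
proof
  have "emeasure unif_S1 (sphere 0 1) = ennreal (1 / (2 * pi)) * ennreal (2 * pi)"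
    by (subst emeasure_unif_S1) (simp_all add: sets_S1_iff)
  also have "\<dots> = 1"
    by (simp flip: ennreal_mult'')
  finally show "emeasure unif_S1 (space unif_S1) = 1"
    by (simp add: space_unif_S1)
qed

lemma nn_integral_periodic_shift:
  fixes g :: "real \<Rightarrow> ennreal"
  assumes [measurable]: "g \<in> borel_measurable borel"
    and per: "\<And>s. g (s + p) = g s" and t: "0 \<le> t" "t < p"
  shows "(\<integral>\<^sup>+s. g (s + t) * indicator {0..<p} s \<partial>lborel) = (\<integral>\<^sup>+s. g s * indicator {0..<p} s \<partial>lborel)"
proof -
  have "(\<integral>\<^sup>+s. g (s + t) * indicator {0..<p} s \<partial>lborel)
      = (\<integral>\<^sup>+s. g s * indicator {t..<t + p} s \<partial>lborel)"
    by (subst nn_integral_real_affine[of _ 1 t])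
      (auto intro!: nn_integral_cong simp: add.commute split: split_indicator)
  also have "\<dots> = (\<integral>\<^sup>+s. g s * indicator {t..<p} s + g s * indicator {p..<p + t} s \<partial>lborel)"
    using t by (intro nn_integral_cong) (auto split: split_indicator)
  also have "\<dots> = (\<integral>\<^sup>+s. g s * indicator {t..<p} s \<partial>lborel) + (\<integral>\<^sup>+s. g s * indicator {p..<p + t} s \<partial>lborel)"
    by (rule nn_integral_add) auto
  also have "(\<integral>\<^sup>+s. g s * indicator {p..<p + t} s \<partial>lborel) = (\<integral>\<^sup>+s. g s * indicator {0..<t} s \<partial>lborel)"
    by (subst nn_integral_real_affine[of _ 1 p])
      (auto intro!: nn_integral_cong simp: add.commute[of p] per split: split_indicator)
  also have "(\<integral>\<^sup>+s. g s * indicator {t..<p} s \<partial>lborel) + \<dots>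
      = (\<integral>\<^sup>+s. g s * indicator {t..<p} s + g s * indicator {0..<t} s \<partial>lborel)"
    by (rule nn_integral_add[symmetric]) auto
  also have "\<dots> = (\<integral>\<^sup>+s. g s * indicator {0..<p} s \<partial>lborel)"
    using t by (intro nn_integral_cong) (auto split: split_indicator)
  finally show ?thesis .
qed

lemma emeasure_sector:
  assumes "E \<in> sets borel"
  shows "emeasure lborel (sector E) = ennreal (measure lebesgue (sector E))"
proof -
  have "emeasure lborel (sector E) = emeasure lebesgue (sector E)"
    using sector_borel[OF assms] by simp
  also have "\<dots> = ennreal (measure lebesgue (sector E))"
    by (rule emeasure_eq_measure2[OF sector_lmeasurable[OF assms]])
  finally show ?thesis .
qed

text \<open>The uniform measure of a set of directions is proportional to the area of its sector. Both
  quantities are invariant under rotations. Averaging the area of the rotated sector over all angles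
  and exchanging the two integrals turns the integral over the angle into \<open>2 * pi\<close> times the uniform
  measure of \<open>E\<close>, whatever the point of the disc. This avoids polar coordinates.\<close>

lemma unif_S1_sector:
  assumes E: "E \<in> sets S1"
  shows "emeasure unif_S1 E * emeasure lborel (sector UNIV) = emeasure lborel (sector E)"
proof -
  have E' [measurable]: "E \<in> sets borel" using E by (simp add: sets_S1_iff)
  have [measurable]: "sector UNIV \<in> sets borel" by (simp add: sector_borel)
  let ?f = "\<lambda>s x. indicator E (sgn (rotation s *v x)) * indicator (sector UNIV) x * indicator {0..<2 * pi} s :: ennreal"
  have rot: "(\<integral>\<^sup>+x. ?f s x \<partial>lborel) = emeasure lborel (sector E) * indicator {0..<2 * pi} s" for s
  proof -
    let ?W = "sector {\<theta>. sgn (rotation s *v \<theta>) \<in> E}"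
    have "{\<theta>. sgn (rotation s *v \<theta>) \<in> E} \<in> sets borel" by measurable
    then have W: "?W \<in> sets borel" "emeasure lborel ?W = ennreal (measure lebesgue ?W)"
      by (simp_all add: sector_borel emeasure_sector)
    have "measure lebesgue ?W = measure lebesgue (sector E)"
      using measure_sector_preimage[of E 1 "rotation s" 1]
      by (simp add: norm_rotation det_rotation)
    moreover have "indicator E (sgn (rotation s *v x)) * indicator (sector UNIV) x = (indicator ?W x :: ennreal)" for x
      by (auto simp: sector_def sgn_matrix_vector_sgn split: split_indicator)
    ultimately show ?thesis
      using W by (simp add: emeasure_sector nn_integral_multc)
  qed
  have circ: "(\<integral>\<^sup>+s. ?f s x \<partial>lborel) = indicator (sector UNIV) x * (ennreal (2 * pi) * emeasure unif_S1 E)" for x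
  proof (cases "x = 0")
    case False
    then obtain t where t: "0 \<le> t" "t < 2 * pi" "sgn x = unit_vec t"
      using sphere_unit_vec[of "sgn x"] by (auto simp: norm_sgn)
    have "sgn (rotation s *v x) = unit_vec (s + t)" for s
      by (subst sgn_matrix_vector_sgn[symmetric])
        (simp only: t(3) rotation_unit_vec, simp add: sgn_div_norm)
    then have "(\<integral>\<^sup>+s. ?f s x \<partial>lborel)
        = (\<integral>\<^sup>+s. indicator (sector UNIV) x * (indicator E (unit_vec (s + t)) * indicator {0..<2 * pi} s) \<partial>lborel)"
      by (simp add: ac_simps)
    also have "\<dots> = indicator (sector UNIV) x * (\<integral>\<^sup>+s. indicator E (unit_vec (s + t)) * indicator {0..<2 * pi} s \<partial>lborel)"
      by (rule nn_integral_cmult) measurable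
    also have "(\<integral>\<^sup>+s. indicator E (unit_vec (s + t)) * indicator {0..<2 * pi} s \<partial>lborel)
        = (\<integral>\<^sup>+s. indicator E (unit_vec s) * indicator {0..<2 * pi} s \<partial>lborel :: ennreal)"
      using t by (intro nn_integral_periodic_shift) (auto simp: unit_vec_periodic)
    also have "\<dots> = ennreal (2 * pi) * emeasure unif_S1 E"
      by (simp add: emeasure_unif_S1[OF E] mult.assoc[symmetric] flip: ennreal_mult'')
    finally show ?thesis .
  qed (simp add: sector_def)
  have "emeasure lborel (sector E) * ennreal (2 * pi)
      = (\<integral>\<^sup>+s. (\<integral>\<^sup>+x. ?f s x \<partial>lborel) \<partial>lborel)"
    unfolding rot by (subst nn_integral_cmult) auto
  also have "\<dots> = (\<integral>\<^sup>+x. (\<integral>\<^sup>+s. ?f s x \<partial>lborel) \<partial>lborel)"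
    by (rule lborel_pair.Fubini') measurable
  also have "\<dots> = emeasure lborel (sector UNIV) * (ennreal (2 * pi) * emeasure unif_S1 E)"
    unfolding circ by (subst nn_integral_multc) auto
  finally have "ennreal (2 * pi) * emeasure lborel (sector E)
      = ennreal (2 * pi) * (emeasure unif_S1 E * emeasure lborel (sector UNIV))"
    by (simp add: ac_simps)
  then show ?thesis
    by (subst (asm) ennreal_mult_cancel_left) auto
qed

lemma measure_sector_UNIV_pos: "0 < measure lebesgue (sector UNIV)"
proof -
  have "sector UNIV = cball 0 1 - {0}"
    by (auto simp: sector_def)
  then have "measure lebesgue (sector UNIV) = measure lebesgue (cball (0::real^2) 1)"
    by (simp add: measure_Diff_null_set)
  then show ?thesis
    by (simp add: content_cball_pos)
qed

section \<open>Distortion of the uniform measure by a linear map\<close>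

lemma direction_map_measurable:
  fixes B :: "real^2^2"
  assumes "det B \<noteq> 0"
  shows "(\<lambda>\<theta>. sgn (B *v \<theta>)) \<in> S1 \<rightarrow>\<^sub>M S1"
proof (intro measurable_restrict_space2 measurable_restrict_space1)
  have "B *v x \<noteq> 0" if "norm x = 1" for x
    using assms that matrix_left_invertible_ker[of B] invertible_left_inverse[of B]
      invertible_det_nz[of B] by auto
  then show "(\<lambda>\<theta>. sgn (B *v \<theta>)) \<in> space (restrict_space borel (sphere 0 1)) \<rightarrow> sphere 0 1"
    by (auto simp: space_restrict_space norm_sgn)
qed measurable

text \<open>An invertible map \<open>B\<close> with singular values \<open>a \<le> b\<close> acts on directions by normalizing \<open>B *v \<theta>\<close>. The
  image of the uniform measure under this action and the uniform measure itself bound each other up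
  to the factor \<open>b / a\<close>.\<close>

lemma direction_map_distortion:
  fixes B :: "real^2^2"
  assumes a: "0 < a" "a \<le> b" and det: "a * b = \<bar>det B\<bar>"
    and lower: "\<And>x. a * norm x \<le> norm (B *v x)"
    and upper: "\<And>x. norm (B *v x) \<le> b * norm x"
  defines "m \<equiv> distr unif_S1 S1 (\<lambda>\<theta>. sgn (B *v \<theta>))"
  shows "m \<le> scale_measure (ennreal (b / a)) unif_S1"
    and "unif_S1 \<le> scale_measure (ennreal (b / a)) m"
proof -
  have b: "0 < b" using a by simp
  then have "det B \<noteq> 0" using a det by auto
  note h = direction_map_measurable[OF this]
  have sets_m: "sets m = sets S1" by (simp add: m_def)
  define K where "K = measure lebesgue (sector UNIV)"
  have K: "0 < K" by (simp add: K_def measure_sector_UNIV_pos)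
  interpret u: prob_space unif_S1 by (rule prob_space_unif_S1)
  have u: "measure unif_S1 E = measure lebesgue (sector E) / K" if "E \<in> sets S1" for E
  proof -
    have "ennreal (measure unif_S1 E * K) = ennreal (measure lebesgue (sector E))"
      using unif_S1_sector[OF that] that emeasure_sector[of UNIV] emeasure_sector[of E]
      by (simp add: u.emeasure_eq_measure K_def ennreal_mult'' sets_S1_iff)
    then show ?thesis using K by (simp add: field_simps)
  qed
  have m: "emeasure m E = ennreal (measure lebesgue (sector {\<theta>. sgn (B *v \<theta>) \<in> E}) / K)"
    if E: "E \<in> sets S1" for E
  proof -
    let ?E = "(\<lambda>\<theta>. sgn (B *v \<theta>)) -` E \<inter> sphere 0 1"
    have "?E \<in> sets S1"
      using measurable_sets[OF h E] by (simp add: space_restrict_space)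
    moreover have "sector ?E = sector {\<theta>. sgn (B *v \<theta>) \<in> E}"
      by (auto simp: sector_def norm_sgn)
    moreover have "emeasure m E = emeasure unif_S1 ?E"
      unfolding m_def using h E by (simp add: emeasure_distr space_unif_S1)
    ultimately show ?thesis
      using u[of ?E] by (simp add: u.emeasure_eq_measure)
  qed
  have le: "emeasure m E \<le> ennreal (b / a) * emeasure unif_S1 E \<and>
    emeasure unif_S1 E \<le> ennreal (b / a) * emeasure m E" if E: "E \<in> sets S1" for E
  proof -
    have E': "E \<in> sets borel" using E by (simp add: sets_S1_iff)
    define v where "v = measure lebesgue (sector E)"
    define w where "w = measure lebesgue (sector {\<theta>. sgn (B *v \<theta>) \<in> E})"
    have "a * a * v \<le> a * b * w" "a * b * w \<le> b * b * v"
      using measure_sector_preimage[OF E' a(1) lower upper] det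
      by (simp_all add: v_def w_def power2_eq_square)
    then have "a * v \<le> b * w" "a * w \<le> b * v"
      using a b by (simp_all add: mult.assoc mult.left_commute[of a b])
    then have "w / K \<le> b / a * (v / K)" "v / K \<le> b / a * (w / K)"
      using a b K by (simp_all add: field_simps)
    moreover have "0 \<le> v / K" "0 \<le> w / K" using K by (simp_all add: v_def w_def)
    moreover have "emeasure unif_S1 E = ennreal (v / K)" "emeasure m E = ennreal (w / K)"
      using u[OF E] m[OF E] by (simp_all add: u.emeasure_eq_measure v_def w_def)
    ultimately show ?thesis
      by (simp add: ennreal_leI flip: ennreal_mult'')
  qed
  show "m \<le> scale_measure (ennreal (b / a)) unif_S1"
    using le emeasure_notin_sets[of _ m] sets_eq_imp_space_eq[of m unif_S1]
    by (subst le_measure) (auto simp: sets_m sets_unif_S1)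
  show "unif_S1 \<le> scale_measure (ennreal (b / a)) m"
    using le by (subst le_measure) (auto simp: sets_m sets_unif_S1)
qed

text \<open>For nonnegative \<open>f\<close> the two integrals differ by a factor between \<open>1 / \<kappa>\<close> and \<open>\<kappa>\<close>, and
  \<open>1 - 1 / \<kappa> \<le> \<kappa> - 1\<close>.\<close>

lemma integral_comparable_measures:
  fixes f :: "'a \<Rightarrow> real"
  assumes sets: "sets M = sets N" and \<kappa>: "1 \<le> \<kappa>"
    and MN: "M \<le> scale_measure (ennreal \<kappa>) N" and NM: "N \<le> scale_measure (ennreal \<kappa>) M"
    and f: "integrable N f"
  shows "\<bar>(\<integral>x. f x \<partial>M) - (\<integral>x. f x \<partial>N)\<bar> \<le> (\<kappa> - 1) * (\<integral>x. \<bar>f x\<bar> \<partial>N)"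
proof -
  have le: "(\<integral>\<^sup>+x. ennreal (g x) \<partial>M) \<le> ennreal \<kappa> * (\<integral>\<^sup>+x. ennreal (g x) \<partial>N)"
    "(\<integral>\<^sup>+x. ennreal (g x) \<partial>N) \<le> ennreal \<kappa> * (\<integral>\<^sup>+x. ennreal (g x) \<partial>M)"
    if [measurable]: "g \<in> borel_measurable N" for g :: "'a \<Rightarrow> real"
  proof -
    have [measurable]: "g \<in> borel_measurable M"
      using that by (simp cong: measurable_cong_sets add: sets)
    show "(\<integral>\<^sup>+x. ennreal (g x) \<partial>M) \<le> ennreal \<kappa> * (\<integral>\<^sup>+x. ennreal (g x) \<partial>N)"
      using nn_integral_mono_measure[OF _ MN, of "\<lambda>x. ennreal (g x)"] sets
      by (simp add: nn_integral_scale_measure)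
    show "(\<integral>\<^sup>+x. ennreal (g x) \<partial>N) \<le> ennreal \<kappa> * (\<integral>\<^sup>+x. ennreal (g x) \<partial>M)"
      using nn_integral_mono_measure[OF _ NM, of "\<lambda>x. ennreal (g x)"] sets
      by (simp add: nn_integral_scale_measure)
  qed
  have pos: "integrable M g \<and> \<bar>(\<integral>x. g x \<partial>M) - (\<integral>x. g x \<partial>N)\<bar> \<le> (\<kappa> - 1) * (\<integral>x. g x \<partial>N)"
    if g: "integrable N g" "\<And>x. 0 \<le> g x" for g :: "'a \<Rightarrow> real"
  proof -
    have gN [measurable]: "g \<in> borel_measurable N" using g(1) by simp
    have gM [measurable]: "g \<in> borel_measurable M"
      using gN by (simp cong: measurable_cong_sets add: sets)
    define J where "J = (\<integral>x. g x \<partial>N)"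
    define I where "I = (\<integral>x. g x \<partial>M)"
    have J: "(\<integral>\<^sup>+x. ennreal (g x) \<partial>N) = ennreal J"
      using g by (simp add: J_def nn_integral_eq_integral)
    have "(\<integral>\<^sup>+x. ennreal (g x) \<partial>M) < \<infinity>"
      using le(1)[OF gN] unfolding J
      by (rule order_le_less_trans) (simp add: ennreal_mult_less_top)
    then have int: "integrable M g"
      using g(2) by (intro integrableI_nonneg) auto
    then have I: "(\<integral>\<^sup>+x. ennreal (g x) \<partial>M) = ennreal I"
      using g by (simp add: I_def nn_integral_eq_integral)
    have nonneg: "0 \<le> I" "0 \<le> J" using g(2) by (simp_all add: I_def J_def)
    have "I \<le> \<kappa> * J" "J \<le> \<kappa> * I"
      using le[OF gN] \<kappa> nonneg unfolding I J
      by (simp_all flip: ennreal_mult'')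
    moreover have "J - I \<le> (\<kappa> - 1) * J"
    proof (cases "I \<le> J")
      case True
      then have "J - I \<le> (\<kappa> - 1) * I" using \<open>J \<le> \<kappa> * I\<close> by (simp add: algebra_simps)
      also have "\<dots> \<le> (\<kappa> - 1) * J" using True \<kappa> by (intro mult_left_mono) auto
      finally show ?thesis .
    next
      case False
      then show ?thesis using \<kappa> nonneg by (smt (verit) mult_nonneg_nonneg)
    qed
    ultimately have "\<bar>I - J\<bar> \<le> (\<kappa> - 1) * J"
      by (auto simp: abs_le_iff algebra_simps)
    then show ?thesis using int by (simp add: I_def J_def)
  qed
  have p: "integrable N (\<lambda>x. max 0 (f x))" "integrable N (\<lambda>x. max 0 (- f x))"
    using f by auto
  note P = pos[OF p(1)] pos[OF p(2)]
  \<comment> \<open>Splitting into positive and negative part reduces the claim to the nonnegative case.\<close>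
  have f_eq: "f x = max 0 (f x) - max 0 (- f x)" for x by auto
  have abs_eq: "\<bar>f x\<bar> = max 0 (f x) + max 0 (- f x)" for x by auto
  have "(\<integral>x. f x \<partial>N) = (\<integral>x. max 0 (f x) \<partial>N) - (\<integral>x. max 0 (- f x) \<partial>N)"
    by (subst f_eq) (rule Bochner_Integration.integral_diff[OF p])
  moreover have "(\<integral>x. f x \<partial>M) = (\<integral>x. max 0 (f x) \<partial>M) - (\<integral>x. max 0 (- f x) \<partial>M)"
    using P by (subst f_eq) (auto intro!: Bochner_Integration.integral_diff)
  moreover have "(\<integral>x. \<bar>f x\<bar> \<partial>N) = (\<integral>x. max 0 (f x) \<partial>N) + (\<integral>x. max 0 (- f x) \<partial>N)"
    unfolding abs_eq by (rule Bochner_Integration.integral_add[OF p])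
  ultimately show ?thesis
    using P by (simp add: distrib_left) linarith
qed

section \<open>Standardization of functions\<close>

lemma borel_probD:
  assumes "M \<in> borel_prob"
  shows "prob_space M" "sets M = sets borel"
  using assms by (auto simp: borel_prob_def)

lemma real_distribution_borel_prob: "\<nu> \<in> borel_prob \<Longrightarrow> real_distribution \<nu>"
  by (simp add: borel_prob_def real_distribution_def real_distribution_axioms_def)

text \<open>Centring and scaling to unit variance. If \<open>g\<close> is not square integrable, or is almost everywhere
  constant, then \<open>std \<rho> g = 0\<close> and the standardization is the zero function (for a probability measure \<open>\<rho>\<close>).\<close>

definition standardize :: "real measure \<Rightarrow> (real \<Rightarrow> real) \<Rightarrow> real \<Rightarrow> real" where
  "standardize \<rho> g t = (g t - mean \<rho> g) / std \<rho> g"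

lemma nrcdt_standardize: "nrcdt \<rho> \<mu> t \<theta> = standardize \<rho> (\<lambda>s. rcdt \<rho> \<mu> s \<theta>) t"
  by (simp add: nrcdt_def standardize_def)

text \<open>Standardization removes affine transformations with positive slope. This remains true if \<open>g\<close> is not
  integrable: then neither \<open>g\<close> nor \<open>h\<close> is square integrable and both sides are zero.\<close>

lemma standardize_affine:
  assumes "prob_space \<rho>" and g: "g \<in> borel_measurable \<rho>" and h: "h \<in> borel_measurable \<rho>"
    and AE: "AE t in \<rho>. h t = r * g t + b" and r: "0 < r" and t: "h t = r * g t + b"
  shows "standardize \<rho> h t = standardize \<rho> g t"
proof -
  interpret prob_space \<rho> by fact
  note [measurable] = g h
  show ?thesis
  proof (cases "integrable \<rho> g")
    case True
    have "mean \<rho> h = (\<integral>t. r * g t + b \<partial>\<rho>)"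
      unfolding mean_def by (rule integral_cong_AE) (use AE in auto)
    also have "\<dots> = r * mean \<rho> g + b"
      using True by (simp add: mean_def prob_space)
    finally have mean: "mean \<rho> h = r * mean \<rho> g + b" .
    have "(\<integral>t. \<bar>h t - mean \<rho> h\<bar>\<^sup>2 \<partial>\<rho>) = (\<integral>t. r\<^sup>2 * \<bar>g t - mean \<rho> g\<bar>\<^sup>2 \<partial>\<rho>)"
    proof (rule integral_cong_AE)
      show "AE t in \<rho>. \<bar>h t - mean \<rho> h\<bar>\<^sup>2 = r\<^sup>2 * \<bar>g t - mean \<rho> g\<bar>\<^sup>2"
        using AE by eventually_elim (simp add: mean power2_eq_square algebra_simps)
    qed auto
    then have "std \<rho> h = r * std \<rho> g"
      using r by (simp add: std_def real_sqrt_mult)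
    moreover have "h t - mean \<rho> h = r * (g t - mean \<rho> g)"
      by (simp add: mean t algebra_simps)
    ultimately show ?thesis
      using r by (simp add: standardize_def)
  next
    case False
    have not_int: "std \<rho> f = 0" if f [measurable]: "f \<in> borel_measurable \<rho>" "\<not> integrable \<rho> f" for f
    proof -
      have "\<not> integrable \<rho> (\<lambda>t. \<bar>f t - mean \<rho> f\<bar>\<^sup>2)"
      proof
        assume "integrable \<rho> (\<lambda>t. \<bar>f t - mean \<rho> f\<bar>\<^sup>2)"
        then have "integrable \<rho> (\<lambda>t. (f t - mean \<rho> f)\<^sup>2)"
          by (simp only: power2_abs)
        then have "integrable \<rho> (\<lambda>t. f t - mean \<rho> f)"
          by (rule square_integrable_imp_integrable[rotated]) measurable
        from Bochner_Integration.integrable_add[OF this integrable_const[of "mean \<rho> f"]]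
        show False using f by simp
      qed
      then show ?thesis by (simp add: std_def not_integrable_integral_eq)
    qed
    have "\<not> integrable \<rho> h"
    proof
      assume "integrable \<rho> h"
      then have "integrable \<rho> (\<lambda>t. (h t - b) / r)" by auto
      moreover have "integrable \<rho> (\<lambda>t. (h t - b) / r) = integrable \<rho> g"
        by (rule integrable_cong_AE) (use AE r in \<open>auto simp: field_simps\<close>)
      ultimately show False using False by simp
    qed
    then show ?thesis
      using False not_int[OF g] not_int[OF h] by (simp add: standardize_def)
  qed
qed

lemma nn_integral_standardize_le:
  assumes g [measurable]: "g \<in> borel_measurable \<rho>"
  shows "(\<integral>\<^sup>+t. ennreal ((standardize \<rho> g t)\<^sup>2) \<partial>\<rho>) \<le> 1"
proof (cases "std \<rho> g = 0")
  case False
  define I where "I = (\<integral>t. \<bar>g t - mean \<rho> g\<bar>\<^sup>2 \<partial>\<rho>)"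
  have "I \<noteq> 0" "0 \<le> I" using False by (auto simp: std_def I_def)
  then have I: "0 < I" by simp
  then have int: "integrable \<rho> (\<lambda>t. \<bar>g t - mean \<rho> g\<bar>\<^sup>2)"
    unfolding I_def using not_integrable_integral_eq by fastforce
  have "(std \<rho> g)\<^sup>2 = I"
    using I by (simp only: std_def I_def[symmetric] real_sqrt_pow2 less_imp_le)
  then have "(standardize \<rho> g t)\<^sup>2 = \<bar>g t - mean \<rho> g\<bar>\<^sup>2 / I" for t
    by (simp only: standardize_def power_divide power2_abs)
  moreover have "(\<integral>\<^sup>+t. ennreal (\<bar>g t - mean \<rho> g\<bar>\<^sup>2 / I) \<partial>\<rho>) = ennreal (I / I)"
    using int I by (subst nn_integral_eq_integral) (auto simp: I_def)
  ultimately show ?thesis using I by simp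
qed (simp add: standardize_def)

section \<open>Affine equivariance of the cumulative distribution transform\<close>

text \<open>The levels \<open>0\<close> and \<open>1\<close> have to be excluded because a quantile may be infinite there, and the
  conversion to the reals would then destroy affine equivariance.\<close>

lemma AE_cdf_strictly_between:
  assumes \<rho>: "\<rho> \<in> borel_prob" and atomless: "\<forall>t. emeasure \<rho> {t} = 0"
  shows "AE t in \<rho>. 0 < cdf \<rho> t \<and> cdf \<rho> t < 1"
proof -
  interpret real_distribution \<rho> using real_distribution_borel_prob[OF \<rho>] .
  have sing: "{t} \<in> null_sets \<rho>" for t
    using atomless by (auto simp: null_sets_def)
  have low: "{..t} \<in> null_sets \<rho>" if "cdf \<rho> t = 0" for t
    using that by (auto simp: null_sets_def cdf_def emeasure_eq_measure)
  have high: "{t..} \<in> null_sets \<rho>" if "cdf \<rho> t = 1" for t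
  proof -
    have "{t<..} = space \<rho> - {..t}" by auto
    then have "prob {t<..} = 0"
      using that prob_compl[of "{..t}"] by (simp add: cdf_def)
    then have "{t<..} \<in> null_sets \<rho>"
      by (auto simp: null_sets_def emeasure_eq_measure)
    from null_sets.Un[OF this sing[of t]] show ?thesis
      by (rule arg_cong[where f="\<lambda>A. A \<in> null_sets \<rho>", THEN iffD1, rotated]) auto
  qed
  \<comment> \<open>A point of the set where the distribution function vanishes is either below a rational point
    of that set or the maximum of the set; dually for the value \<open>1\<close>.\<close>
  let ?L = "(\<Union>q\<in>{q\<in>\<rat>. cdf \<rho> q = 0}. {..q}) \<union> {Sup {t. cdf \<rho> t = 0}}"
  let ?H = "(\<Union>q\<in>{q\<in>\<rat>. cdf \<rho> q = 1}. {q..}) \<union> {Inf {t. cdf \<rho> t = 1}}"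
  have count: "countable {q \<in> \<rat>. P q}" for P :: "real \<Rightarrow> bool"
    by (rule countable_subset[OF _ countable_rat]) auto
  have L: "?L \<in> null_sets \<rho>"
    by (intro null_sets.Un null_sets_UN' count sing) (use low in auto)
  have H: "?H \<in> null_sets \<rho>"
    by (intro null_sets.Un null_sets_UN' count sing) (use high in auto)
  have in_L: "t \<in> ?L" if t: "cdf \<rho> t = 0" for t
  proof (cases "\<exists>t'>t. cdf \<rho> t' = 0")
    case True
    then obtain t' where t': "t < t'" "cdf \<rho> t' = 0" by auto
    then obtain q where q: "q \<in> \<rat>" "t < q" "q < t'" using Rats_dense_in_real by blast
    then have "cdf \<rho> q = 0"
      using cdf_nondecreasing[of q t'] cdf_nonneg[of q] t' by auto
    then show ?thesis using q by force
  next
    case False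
    then have "Sup {t. cdf \<rho> t = 0} = t"
      using t by (intro cSup_eq_maximum) (auto simp: not_less)
    then show ?thesis by simp
  qed
  have in_H: "t \<in> ?H" if t: "cdf \<rho> t = 1" for t
  proof (cases "\<exists>t'<t. cdf \<rho> t' = 1")
    case True
    then obtain t' where t': "t' < t" "cdf \<rho> t' = 1" by auto
    then obtain q where q: "q \<in> \<rat>" "t' < q" "q < t" using Rats_dense_in_real by blast
    then have "cdf \<rho> q = 1"
      using cdf_nondecreasing[of t' q] cdf_bounded_prob[of q] t' by auto
    then show ?thesis using q by force
  next
    case False
    then have "Inf {t. cdf \<rho> t = 1} = t"
      using t by (intro cInf_eq_minimum) (auto simp: not_less)
    then show ?thesis by simp
  qed
  have "t \<in> ?L \<union> ?H" if "\<not> (0 < cdf \<rho> t \<and> cdf \<rho> t < 1)" for t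
  proof -
    have "cdf \<rho> t = 0 \<or> cdf \<rho> t = 1"
      using that cdf_nonneg[of t] cdf_bounded_prob[of t] by linarith
    then show ?thesis using in_L in_H by blast
  qed
  then show ?thesis
    by (intro AE_I'[OF null_sets.Un[OF L H]]) blast
qed

lemma real_of_quantile:
  assumes "real_distribution \<nu>" and p: "0 < p" "p < 1"
  shows "{s. p < cdf \<nu> s} \<noteq> {}" "bdd_below {s. p < cdf \<nu> s}"
    "real_of_ereal (quantile \<nu> p) = Inf {s. p < cdf \<nu> s}"
proof -
  interpret real_distribution \<nu> by fact
  have "eventually (\<lambda>s. p < cdf \<nu> s) at_top"
    using cdf_lim_at_top_prob p by (intro order_tendstoD)
  then show ne: "{s. p < cdf \<nu> s} \<noteq> {}"
    by (auto dest: eventually_happens)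
  have "eventually (\<lambda>s. cdf \<nu> s < p) at_bot"
    using cdf_lim_at_bot p by (intro order_tendstoD)
  then obtain a where "\<And>s. s \<le> a \<Longrightarrow> cdf \<nu> s < p"
    by (auto simp: eventually_at_bot_linorder)
  then show bdd: "bdd_below {s. p < cdf \<nu> s}"
    by (intro bdd_belowI[of _ a]) (smt (verit) mem_Collect_eq)
  show "real_of_ereal (quantile \<nu> p) = Inf {s. p < cdf \<nu> s}"
    unfolding quantile_def ereal_Inf'[OF bdd ne, symmetric] by simp
qed

lemma cdt_affine:
  assumes \<nu>: "real_distribution \<nu>" and r: "0 < r" and t: "0 < cdf \<rho> t" "cdf \<rho> t < 1"
  shows "cdt \<rho> (distr \<nu> borel (\<lambda>x. r * x + b)) t = r * cdt \<rho> \<nu> t + b"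
proof -
  interpret real_distribution \<nu> by fact
  define \<nu>' where "\<nu>' = distr \<nu> borel (\<lambda>x. r * x + b)"
  have \<nu>': "real_distribution \<nu>'"
    unfolding \<nu>'_def by (rule real_distribution_distr) simp
  define S where "S = {s. cdf \<rho> t < cdf \<nu> s}"
  note S = real_of_quantile[OF \<nu> t, folded S_def]
  have cdf': "cdf \<nu>' (r * s + b) = cdf \<nu> s" for s
  proof -
    have "(\<lambda>x. r * x + b) -` {..r * s + b} \<inter> space \<nu> = {..s}" using r by auto
    then show ?thesis
      unfolding cdf_def \<nu>'_def by (subst measure_distr) auto
  qed
  have "{s. cdf \<rho> t < cdf \<nu>' s} = (\<lambda>s. r * s + b) ` S"
  proof (intro set_eqI iffI)
    fix s assume "s \<in> {s. cdf \<rho> t < cdf \<nu>' s}"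
    then show "s \<in> (\<lambda>s. r * s + b) ` S"
      using r cdf'[of "(s - b) / r"] by (intro image_eqI[of _ _ "(s - b) / r"]) (auto simp: S_def)
  qed (auto simp: S_def cdf')
  moreover have "r * Inf S + b = (INF s\<in>S. r * s + b)"
    using r S(1,2) by (intro continuous_at_Inf_mono) (auto intro!: monoI continuous_intros)
  ultimately show ?thesis
    using real_of_quantile(3)[OF \<nu>' t] S(3) by (simp add: cdt_def \<nu>'_def)
qed

section \<open>Radon transforms of affine images\<close>

lemma real_distribution_radon:
  assumes "\<mu> \<in> borel_prob"
  shows "real_distribution (radon \<mu> \<theta>)"
proof -
  interpret prob_space \<mu> using borel_probD[OF assms] by simp
  note [measurable_cong] = borel_probD(2)[OF assms]
  show ?thesis unfolding radon_def by (rule real_distribution_distr) measurable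
qed

text \<open>An affine map of the plane changes the direction of projection to the normalized vector
  \<open>transpose A *v \<theta>\<close>; what remains is an affine map of the line.\<close>

lemma radon_affine:
  assumes "\<mu> \<in> borel_prob"
  shows "radon (distr \<mu> borel (\<lambda>x. A *v x + y)) \<theta>
    = distr (radon \<mu> (sgn (transpose A *v \<theta>))) borel (\<lambda>s. norm (transpose A *v \<theta>) * s + y \<bullet> \<theta>)"
proof -
  note [measurable_cong] = borel_probD(2)[OF assms]
  have "(A *v x + y) \<bullet> \<theta> = norm (transpose A *v \<theta>) * (x \<bullet> sgn (transpose A *v \<theta>)) + y \<bullet> \<theta>" for x
  proof -
    have "(A *v x) \<bullet> \<theta> = x \<bullet> (transpose A *v \<theta>)"
      by (metis dot_lmul_matrix inner_commute vector_transpose_matrix transpose_transpose)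
    moreover have "norm v *\<^sub>R sgn v = v" for v :: "real^2"
      by (cases "v = 0") (simp_all add: sgn_div_norm)
    ultimately show ?thesis
      by (metis inner_add_left inner_scaleR_right)
  qed
  then show ?thesis
    unfolding radon_def by (subst (1 2) distr_distr) (auto simp: comp_def)
qed

section \<open>Joint measurability of the normalized transform\<close>

text \<open>Restricting to rational points makes the sublevel sets of the quantile countable unions, whence
  joint measurability of the transform.\<close>

lemma quantile_less_iff:
  assumes "real_distribution \<nu>"
  shows "quantile \<nu> p < a \<longleftrightarrow> (\<exists>q\<in>\<rat>. ereal q < a \<and> p < cdf \<nu> q)"
proof
  interpret real_distribution \<nu> by fact
  assume "quantile \<nu> p < a"
  then obtain s where s: "p < cdf \<nu> s" "ereal s < a"
    by (auto simp: quantile_def Inf_less_iff)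
  then obtain z where "s < z" "ereal z < a"
    by (metis ereal_dense2 ereal_less_eq(3) less_ereal.simps(1))
  then obtain q where q: "q \<in> \<rat>" "s < q" "q < z" using Rats_dense_in_real by blast
  then have "ereal q < a" using \<open>ereal z < a\<close> by (meson less_ereal.simps(1) less_trans)
  then show "\<exists>q\<in>\<rat>. ereal q < a \<and> p < cdf \<nu> q"
    using s q cdf_nondecreasing[of s q] by (intro bexI[of _ q]) auto
qed (auto simp: quantile_def Inf_less_iff)

lemma rcdt_measurable:
  assumes \<rho>: "\<rho> \<in> borel_prob" and \<mu>: "\<mu> \<in> borel_prob"
  shows "(\<lambda>(t, \<theta>). rcdt \<rho> \<mu> t \<theta>) \<in> borel_measurable (borel \<Otimes>\<^sub>M borel)"
proof -
  interpret M: prob_space \<mu> using borel_probD[OF \<mu>] by simp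
  interpret R: real_distribution \<rho> using real_distribution_borel_prob[OF \<rho>] .
  note [measurable_cong] = borel_probD(2)[OF \<mu>]
  have cdf_radon [measurable]: "(\<lambda>\<theta>. cdf (radon \<mu> \<theta>) q) \<in> borel_measurable borel" for q
  proof -
    have "cdf (radon \<mu> \<theta>) q = (\<integral>x. indicator {..q} (x \<bullet> \<theta>) \<partial>\<mu>)" for \<theta>
    proof -
      have "cdf (radon \<mu> \<theta>) q = (\<integral>s. indicator {..q} s \<partial>radon \<mu> \<theta>)"
        by (simp add: cdf_def radon_def)
      then show ?thesis unfolding radon_def by (subst (asm) integral_distr) auto
    qed
    then show ?thesis by simp
  qed
  have cdf_\<rho> [measurable]: "cdf \<rho> \<in> borel_measurable borel"
    using R.cdf_nondecreasing by (intro borel_measurable_mono monoI)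
  have "(\<lambda>(t, \<theta>). quantile (radon \<mu> \<theta>) (cdf \<rho> t)) \<in> borel_measurable (borel \<Otimes>\<^sub>M borel)"
  proof (rule borel_measurableI_less)
    fix a :: ereal
    have "{x \<in> space (borel \<Otimes>\<^sub>M borel). (case x of (t, \<theta>) \<Rightarrow> quantile (radon \<mu> \<theta>) (cdf \<rho> t)) < a}
      = (\<Union>q\<in>{q\<in>\<rat>. ereal q < a}. {x \<in> space (borel \<Otimes>\<^sub>M borel). cdf \<rho> (fst x) < cdf (radon \<mu> (snd x)) q})"
      by (auto simp: quantile_less_iff[OF real_distribution_radon[OF \<mu>]])
    also have "\<dots> \<in> sets (borel \<Otimes>\<^sub>M borel)"
      using countable_rat by (intro sets.countable_UN'') (auto intro: countable_subset)
    finally show "{x \<in> space (borel \<Otimes>\<^sub>M borel). (case x of (t, \<theta>) \<Rightarrow> quantile (radon \<mu> \<theta>) (cdf \<rho> t)) < a}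
      \<in> sets (borel \<Otimes>\<^sub>M borel)" .
  qed
  then show ?thesis
    unfolding rcdt_def cdt_def by measurable
qed

lemma nrcdt_measurable:
  assumes \<rho>: "\<rho> \<in> borel_prob" and \<mu>: "\<mu> \<in> borel_prob"
  shows "(\<lambda>(t, \<theta>). nrcdt \<rho> \<mu> t \<theta>) \<in> borel_measurable (borel \<Otimes>\<^sub>M borel)"
proof -
  interpret R: prob_space \<rho> using borel_probD[OF \<rho>] by simp
  note [measurable_cong] = borel_probD(2)[OF \<rho>]
  note [measurable] = rcdt_measurable[OF \<rho> \<mu>]
  show ?thesis
    unfolding nrcdt_def std_def mean_def by measurable
qed

section \<open>Affine equivariance of the normalized transform\<close>

text \<open>The exceptional null set of \<open>t\<close> does not depend on \<open>\<theta>\<close>, so that the identity can be integrated over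
  the circle.\<close>

lemma nrcdt_affine:
  assumes \<rho>: "\<rho> \<in> borel_prob" and atomless: "\<forall>t. emeasure \<rho> {t} = 0"
    and \<mu>: "\<mu> \<in> borel_prob" and A: "invertible A"
  shows "AE t in \<rho>. \<forall>\<theta>\<in>sphere 0 1.
    nrcdt \<rho> (distr \<mu> borel (\<lambda>x. A *v x + y)) t \<theta> = nrcdt \<rho> \<mu> t (sgn (transpose A *v \<theta>))"
proof -
  interpret R: prob_space \<rho> using borel_probD[OF \<rho>] by simp
  interpret M: prob_space \<mu> using borel_probD[OF \<mu>] by simp
  note [measurable_cong] = borel_probD(2)[OF \<rho>] borel_probD(2)[OF \<mu>]
  define \<mu>' where "\<mu>' = distr \<mu> borel (\<lambda>x. A *v x + y)"
  have \<mu>': "\<mu>' \<in> borel_prob"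
    by (simp add: \<mu>'_def borel_prob_def M.prob_space_distr)
  have meas: "(\<lambda>t. rcdt \<rho> \<nu> t \<theta>) \<in> borel_measurable \<rho>" if "\<nu> \<in> borel_prob" for \<nu> \<theta>
  proof -
    note [measurable] = rcdt_measurable[OF \<rho> that]
    show ?thesis by measurable
  qed
  note good = AE_cdf_strictly_between[OF \<rho> atomless]
  show ?thesis
    using good
  proof eventually_elim
    fix t assume t: "0 < cdf \<rho> t \<and> cdf \<rho> t < 1"
    show "\<forall>\<theta>\<in>sphere 0 1. nrcdt \<rho> (distr \<mu> borel (\<lambda>x. A *v x + y)) t \<theta>
      = nrcdt \<rho> \<mu> t (sgn (transpose A *v \<theta>))"
    proof
      fix \<theta> :: "real^2" assume "\<theta> \<in> sphere 0 1"
      then have "transpose A *v \<theta> \<noteq> 0"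
        using A matrix_left_invertible_ker[of "transpose A"] invertible_left_inverse[of "transpose A"]
          invertible_det_nz[of "transpose A"] invertible_det_nz[of A] by auto
      then have r: "0 < norm (transpose A *v \<theta>)" by simp
      have eq: "rcdt \<rho> \<mu>' t \<theta>
          = norm (transpose A *v \<theta>) * rcdt \<rho> \<mu> t (sgn (transpose A *v \<theta>)) + y \<bullet> \<theta>"
        if "0 < cdf \<rho> t \<and> cdf \<rho> t < 1" for t
        unfolding rcdt_def \<mu>'_def radon_affine[OF \<mu>]
        using that by (intro cdt_affine real_distribution_radon \<mu> r) auto
      have "nrcdt \<rho> \<mu>' t \<theta> = nrcdt \<rho> \<mu> t (sgn (transpose A *v \<theta>))"
        unfolding nrcdt_standardize
      proof (rule standardize_affine)
        show "AE t in \<rho>. rcdt \<rho> \<mu>' t \<theta>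
          = norm (transpose A *v \<theta>) * rcdt \<rho> \<mu> t (sgn (transpose A *v \<theta>)) + y \<bullet> \<theta>"
          using good by eventually_elim (rule eq)
      qed (use t r eq meas \<mu> \<mu>' R.prob_space_axioms in auto)
      then show "nrcdt \<rho> (distr \<mu> borel (\<lambda>x. A *v x + y)) t \<theta>
          = nrcdt \<rho> \<mu> t (sgn (transpose A *v \<theta>))"
        by (simp add: \<mu>'_def)
    qed
  qed
qed

section \<open>Square integrable functions\<close>

lemma L2_mult_integrable:
  assumes "f \<in> L2_space M" "g \<in> L2_space M"
  shows "integrable M (\<lambda>x. f x * g x)"
proof (rule Bochner_Integration.integrable_bound)
  show "integrable M (\<lambda>x. (f x)\<^sup>2 + (g x)\<^sup>2)"
    using assms by (auto simp: L2_space_def)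
  show "(\<lambda>x. f x * g x) \<in> borel_measurable M"
    using assms by (auto simp: L2_space_def)
  have "\<bar>a * b\<bar> \<le> a\<^sup>2 + b\<^sup>2" for a b :: real
  proof -
    have "0 \<le> (\<bar>a\<bar> - \<bar>b\<bar>)\<^sup>2" by simp
    then have "2 * \<bar>a * b\<bar> \<le> a\<^sup>2 + b\<^sup>2" by (simp add: power2_diff abs_mult)
    then show ?thesis using abs_ge_zero[of "a * b"] by linarith
  qed
  then show "AE x in M. norm (f x * g x) \<le> norm ((f x)\<^sup>2 + (g x)\<^sup>2)"
    by simp
qed

lemma L2_space_diff:
  assumes "f \<in> L2_space M" "g \<in> L2_space M"
  shows "(\<lambda>x. f x - g x) \<in> L2_space M"
proof -
  have "integrable M (\<lambda>x. (f x)\<^sup>2 + (g x)\<^sup>2 - 2 * (f x * g x))"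
    using assms L2_mult_integrable[OF assms] unfolding L2_space_def
    by (intro Bochner_Integration.integrable_diff Bochner_Integration.integrable_add
        integrable_mult_right) auto
  then show ?thesis
    using assms by (auto simp: L2_space_def power2_diff mult.assoc)
qed

lemma L2_norm_nonneg: "0 \<le> L2_norm M f"
  by (simp add: L2_norm_def)

lemma L2_norm_square: "(L2_norm M f)\<^sup>2 = (\<integral>x. (f x)\<^sup>2 \<partial>M)"
  by (simp add: L2_norm_def)

lemma L2_Cauchy_Schwarz:
  assumes f: "f \<in> L2_space M" and g: "g \<in> L2_space M"
  shows "\<bar>\<integral>x. f x * g x \<partial>M\<bar> \<le> L2_norm M f * L2_norm M g"
proof -
  define a where "a = (\<integral>x. (f x)\<^sup>2 \<partial>M)"
  define b where "b = (\<integral>x. f x * g x \<partial>M)"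
  define c where "c = (\<integral>x. (g x)\<^sup>2 \<partial>M)"
  have int: "integrable M (\<lambda>x. (f x)\<^sup>2)" "integrable M (\<lambda>x. (g x)\<^sup>2)"
    "integrable M (\<lambda>x. f x * g x)"
    using f g L2_mult_integrable[OF f g] by (auto simp: L2_space_def)
  \<comment> \<open>The discriminant of the quadratic polynomial \<open>s \<mapsto> \<parallel>f - s g\<parallel>\<^sup>2\<close> is not positive.\<close>
  have quad: "0 \<le> a - 2 * s * b + s\<^sup>2 * c" for s
  proof -
    have "0 \<le> (\<integral>x. (f x - s * g x)\<^sup>2 \<partial>M)" by simp
    also have "\<dots> = (\<integral>x. (f x)\<^sup>2 - (2 * s) * (f x * g x) + s\<^sup>2 * (g x)\<^sup>2 \<partial>M)"
      by (intro Bochner_Integration.integral_cong) (auto simp: power2_eq_square algebra_simps)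
    also have "\<dots> = a - 2 * s * b + s\<^sup>2 * c"
      using int by (simp add: a_def b_def c_def)
    finally show ?thesis .
  qed
  have "0 \<le> c" by (simp add: c_def)
  have "b\<^sup>2 \<le> a * c"
  proof (cases "c = 0")
    case True
    then have "b = 0"
      using quad[of "(a + 1) / (2 * b)"] by (cases "b = 0") (auto simp: field_simps)
    then show ?thesis using True by simp
  next
    case False
    then have "0 < c" using \<open>0 \<le> c\<close> by simp
    moreover have "(b / c)\<^sup>2 * c = b\<^sup>2 / c" "2 * (b / c) * b = 2 * (b\<^sup>2 / c)"
      using False by (simp_all add: power2_eq_square)
    ultimately have "b\<^sup>2 / c \<le> a"
      using quad[of "b / c"] by linarith
    then show ?thesis using \<open>0 < c\<close> by (simp add: pos_divide_le_eq)
  qed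
  then have "\<bar>b\<bar> \<le> sqrt (a * c)"
    by (rule real_le_rsqrt[of "\<bar>b\<bar>", simplified power2_abs])
  then show ?thesis
    by (simp add: a_def b_def c_def L2_norm_def real_sqrt_mult)
qed

lemma continuous_linear_functional_L2_inner:
  assumes g: "g \<in> L2_space M"
  shows "continuous_linear_functional_L2 M (\<lambda>f. \<integral>x. f x * g x \<partial>M)"
  unfolding continuous_linear_functional_L2_def
proof (intro conjI ballI allI impI)
  fix f h assume fh: "f \<in> L2_space M" "h \<in> L2_space M"
  show "(\<integral>x. (f x + h x) * g x \<partial>M) = (\<integral>x. f x * g x \<partial>M) + (\<integral>x. h x * g x \<partial>M)"
    using L2_mult_integrable[OF _ g] fh by (simp add: distrib_right)
next
  fix f :: "'a \<Rightarrow> real" and a :: real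
  show "(\<integral>x. a * f x * g x \<partial>M) = a * (\<integral>x. f x * g x \<partial>M)"
    by (simp add: mult.assoc)
next
  fix f and e :: real assume f: "f \<in> L2_space M" and e: "0 < e"
  define K where "K = L2_norm M g + 1"
  have K: "0 < K" "L2_norm M g \<le> K" using L2_norm_nonneg[of M g] by (auto simp: K_def)
  show "\<exists>d>0. \<forall>h\<in>L2_space M. L2_norm M (\<lambda>x. h x - f x) < d \<longrightarrow>
    \<bar>(\<integral>x. h x * g x \<partial>M) - (\<integral>x. f x * g x \<partial>M)\<bar> < e"
  proof (intro exI[of _ "e / K"] conjI ballI impI)
    show "0 < e / K" using e K by simp
    fix h assume h: "h \<in> L2_space M" and d: "L2_norm M (\<lambda>x. h x - f x) < e / K"
    have "\<bar>(\<integral>x. h x * g x \<partial>M) - (\<integral>x. f x * g x \<partial>M)\<bar> = \<bar>\<integral>x. (h x - f x) * g x \<partial>M\<bar>"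
      using L2_mult_integrable[OF _ g] f h by (simp add: left_diff_distrib)
    also have "\<dots> \<le> L2_norm M (\<lambda>x. h x - f x) * L2_norm M g"
      by (rule L2_Cauchy_Schwarz[OF L2_space_diff[OF h f] g])
    also have "\<dots> \<le> L2_norm M (\<lambda>x. h x - f x) * K"
      using K L2_norm_nonneg by (intro mult_left_mono)
    also have "\<dots> < e" using d K by (simp add: pos_less_divide_eq)
    finally show "\<bar>(\<integral>x. h x * g x \<partial>M) - (\<integral>x. f x * g x \<partial>M)\<bar> < e" .
  qed
qed

lemma (in prob_space) square_integral_abs_le:
  fixes f :: "'a \<Rightarrow> real"
  assumes [measurable]: "f \<in> borel_measurable M" and sq: "integrable M (\<lambda>x. (f x)\<^sup>2)"
  shows "(\<integral>x. \<bar>f x\<bar> \<partial>M)\<^sup>2 \<le> (\<integral>x. (f x)\<^sup>2 \<partial>M)"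
proof -
  have int: "integrable M f" by (rule square_integrable_imp_integrable[OF _ sq]) measurable
  have "0 \<le> variance (\<lambda>x. \<bar>f x\<bar>)" by (rule variance_positive)
  also have "\<dots> = (\<integral>x. (\<bar>f x\<bar>)\<^sup>2 \<partial>M) - (\<integral>x. \<bar>f x\<bar> \<partial>M)\<^sup>2"
    using int sq by (intro variance_eq) auto
  finally show ?thesis by simp
qed

section \<open>The normalized transform as a square integrable function\<close>

lemma nrcdt_measurable_S1:
  assumes \<rho>: "\<rho> \<in> borel_prob" and \<mu>: "\<mu> \<in> borel_prob"
  shows "(\<lambda>(t, \<theta>). nrcdt \<rho> \<mu> t \<theta>) \<in> borel_measurable (\<rho> \<Otimes>\<^sub>M unif_S1)"
proof -
  have "(\<lambda>\<theta>. \<theta>) \<in> unif_S1 \<rightarrow>\<^sub>M borel"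
    unfolding measurable_cong_sets[OF sets_unif_S1 refl]
    by (rule measurable_restrict_space1) simp
  moreover have "(\<lambda>t. t) \<in> \<rho> \<rightarrow>\<^sub>M borel"
    using borel_probD(2)[OF \<rho>] by (simp add: measurable_ident_sets)
  ultimately have "(\<lambda>x. (fst x, snd x)) \<in> \<rho> \<Otimes>\<^sub>M unif_S1 \<rightarrow>\<^sub>M borel \<Otimes>\<^sub>M borel"
    by (intro measurable_Pair measurable_compose[OF measurable_fst] measurable_compose[OF measurable_snd])
  from measurable_compose[OF this nrcdt_measurable[OF \<rho> \<mu>]] show ?thesis
    by (simp add: case_prod_unfold)
qed

text \<open>For every direction the standardized function has norm at most one, so Tonelli's theorem applies.\<close>

lemma nrcdt_square_integrable:
  assumes \<rho>: "\<rho> \<in> borel_prob" and \<mu>: "\<mu> \<in> borel_prob"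
  shows "integrable (\<rho> \<Otimes>\<^sub>M unif_S1) (\<lambda>x. (nrcdt \<rho> \<mu> (fst x) (snd x))\<^sup>2)"
proof -
  interpret R: prob_space \<rho> using borel_probD[OF \<rho>] by simp
  interpret U: prob_space unif_S1 by (rule prob_space_unif_S1)
  interpret pair_sigma_finite \<rho> unif_S1 ..
  have N [measurable]: "(\<lambda>x. nrcdt \<rho> \<mu> (fst x) (snd x)) \<in> borel_measurable (\<rho> \<Otimes>\<^sub>M unif_S1)"
    using nrcdt_measurable_S1[OF \<rho> \<mu>] by (simp add: case_prod_unfold)
  have slice: "(\<lambda>t. rcdt \<rho> \<mu> t \<theta>) \<in> borel_measurable \<rho>" for \<theta>
  proof -
    note [measurable_cong] = borel_probD(2)[OF \<rho>]
    note [measurable] = rcdt_measurable[OF \<rho> \<mu>]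
    show ?thesis by measurable
  qed
  have "(\<integral>\<^sup>+x. ennreal ((nrcdt \<rho> \<mu> (fst x) (snd x))\<^sup>2) \<partial>(\<rho> \<Otimes>\<^sub>M unif_S1))
      = (\<integral>\<^sup>+\<theta>. \<integral>\<^sup>+t. ennreal ((nrcdt \<rho> \<mu> t \<theta>)\<^sup>2) \<partial>\<rho> \<partial>unif_S1)"
    by (subst nn_integral_snd[symmetric]) auto
  also have "\<dots> \<le> (\<integral>\<^sup>+\<theta>. 1 \<partial>unif_S1)"
    unfolding nrcdt_standardize by (intro nn_integral_mono nn_integral_standardize_le slice)
  also have "\<dots> < \<infinity>" by (simp add: U.emeasure_space_1)
  finally show ?thesis
    by (intro integrableI_nonneg) auto
qed

lemma AE_nrcdt_slice:
  assumes \<rho>: "\<rho> \<in> borel_prob" and \<mu>: "\<mu> \<in> borel_prob"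
  shows "AE t in \<rho>. integrable unif_S1 (nrcdt \<rho> \<mu> t) \<and>
    (\<integral>\<theta>. \<bar>nrcdt \<rho> \<mu> t \<theta>\<bar> \<partial>unif_S1)\<^sup>2 \<le> (\<integral>\<theta>. (nrcdt \<rho> \<mu> t \<theta>)\<^sup>2 \<partial>unif_S1)"
proof -
  interpret R: prob_space \<rho> using borel_probD[OF \<rho>] by simp
  interpret U: prob_space unif_S1 by (rule prob_space_unif_S1)
  interpret pair_sigma_finite \<rho> unif_S1 ..
  have N [measurable]: "nrcdt \<rho> \<mu> t \<in> borel_measurable unif_S1" if "t \<in> space \<rho>" for t
    using measurable_compose[OF measurable_Pair1'[OF that] nrcdt_measurable_S1[OF \<rho> \<mu>]] by simp
  have "AE t in \<rho>. t \<in> space \<rho>" by (rule AE_space)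
  then show ?thesis
    using AE_integrable_fst'[OF nrcdt_square_integrable[OF \<rho> \<mu>]]
  proof eventually_elim
    fix t assume "t \<in> space \<rho>"
      and sq: "integrable unif_S1 (\<lambda>\<theta>. (nrcdt \<rho> \<mu> (fst (t, \<theta>)) (snd (t, \<theta>)))\<^sup>2)"
    then show "integrable unif_S1 (nrcdt \<rho> \<mu> t) \<and>
      (\<integral>\<theta>. \<bar>nrcdt \<rho> \<mu> t \<theta>\<bar> \<partial>unif_S1)\<^sup>2 \<le> (\<integral>\<theta>. (nrcdt \<rho> \<mu> t \<theta>)\<^sup>2 \<partial>unif_S1)"
      using U.square_integrable_imp_integrable[OF N] U.square_integral_abs_le[OF N] by simp
  qed
qed

lemma mean_nrcdt_measurable:
  assumes \<rho>: "\<rho> \<in> borel_prob" and \<mu>: "\<mu> \<in> borel_prob"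
  shows "mean_nrcdt \<rho> \<mu> \<in> borel_measurable \<rho>"
proof -
  interpret U: prob_space unif_S1 by (rule prob_space_unif_S1)
  show ?thesis
    unfolding mean_nrcdt_def[abs_def]
    by (rule U.borel_measurable_lebesgue_integral[OF nrcdt_measurable_S1[OF \<rho> \<mu>]])
qed

lemma integrable_slice_square:
  assumes \<rho>: "\<rho> \<in> borel_prob" and \<mu>: "\<mu> \<in> borel_prob"
  shows "integrable \<rho> (\<lambda>t. \<integral>\<theta>. (nrcdt \<rho> \<mu> t \<theta>)\<^sup>2 \<partial>unif_S1)"
    and "(\<integral>t. (\<integral>\<theta>. (nrcdt \<rho> \<mu> t \<theta>)\<^sup>2 \<partial>unif_S1) \<partial>\<rho>)
      = (L2_norm (\<rho> \<Otimes>\<^sub>M unif_S1) (\<lambda>(t, \<theta>). nrcdt \<rho> \<mu> t \<theta>))\<^sup>2"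
proof -
  interpret R: prob_space \<rho> using borel_probD[OF \<rho>] by simp
  interpret U: prob_space unif_S1 by (rule prob_space_unif_S1)
  interpret pair_sigma_finite \<rho> unif_S1 ..
  show "integrable \<rho> (\<lambda>t. \<integral>\<theta>. (nrcdt \<rho> \<mu> t \<theta>)\<^sup>2 \<partial>unif_S1)"
    using integrable_fst'[OF nrcdt_square_integrable[OF \<rho> \<mu>]] by simp
  show "(\<integral>t. (\<integral>\<theta>. (nrcdt \<rho> \<mu> t \<theta>)\<^sup>2 \<partial>unif_S1) \<partial>\<rho>)
      = (L2_norm (\<rho> \<Otimes>\<^sub>M unif_S1) (\<lambda>(t, \<theta>). nrcdt \<rho> \<mu> t \<theta>))\<^sup>2"
    using integral_fst'[OF nrcdt_square_integrable[OF \<rho> \<mu>]]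
    by (simp add: L2_norm_square case_prod_unfold)
qed

lemma mean_nrcdt_L2:
  assumes \<rho>: "\<rho> \<in> borel_prob" and \<mu>: "\<mu> \<in> borel_prob"
  shows "mean_nrcdt \<rho> \<mu> \<in> L2_space \<rho>"
proof -
  note [measurable] = mean_nrcdt_measurable[OF \<rho> \<mu>]
  have "integrable \<rho> (\<lambda>t. (mean_nrcdt \<rho> \<mu> t)\<^sup>2)"
  proof (rule Bochner_Integration.integrable_bound[OF integrable_slice_square(1)[OF \<rho> \<mu>]])
    show "AE t in \<rho>. norm ((mean_nrcdt \<rho> \<mu> t)\<^sup>2) \<le> norm (\<integral>\<theta>. (nrcdt \<rho> \<mu> t \<theta>)\<^sup>2 \<partial>unif_S1)"
      using AE_nrcdt_slice[OF \<rho> \<mu>]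
    proof eventually_elim
      case (elim t)
      have "\<bar>mean_nrcdt \<rho> \<mu> t\<bar> \<le> (\<integral>\<theta>. \<bar>nrcdt \<rho> \<mu> t \<theta>\<bar> \<partial>unif_S1)"
        unfolding mean_nrcdt_def by (rule integral_abs_bound)
      then have "\<bar>mean_nrcdt \<rho> \<mu> t\<bar>\<^sup>2 \<le> (\<integral>\<theta>. \<bar>nrcdt \<rho> \<mu> t \<theta>\<bar> \<partial>unif_S1)\<^sup>2"
        by (rule power_mono) simp
      with elim show ?case by simp
    qed
  qed measurable
  then show ?thesis by (simp add: L2_space_def mean_nrcdt_measurable[OF \<rho> \<mu>])
qed

section \<open>Stability of the mean-normalized transform and separation\<close>

text \<open>By equivariance the mean-normalized transform of the affine image is the integral of \<open>nrcdt \<rho> \<mu> t\<close>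
  against the distorted uniform measure on the circle.\<close>

lemma mean_nrcdt_affine_distance:
  fixes A :: "real^2^2" and y :: "real^2"
  assumes \<rho>: "\<rho> \<in> borel_prob" and atomless: "\<forall>t. emeasure \<rho> {t} = 0"
    and \<mu>: "\<mu> \<in> borel_prob" and A: "invertible A"
  defines "\<mu>' \<equiv> distr \<mu> borel (\<lambda>x. A *v x + y)"
  shows "L2_norm \<rho> (\<lambda>t. mean_nrcdt \<rho> \<mu>' t - mean_nrcdt \<rho> \<mu> t)
    \<le> (sigma_max A - sigma_min A) / sigma_min A
      * L2_norm (\<rho> \<Otimes>\<^sub>M unif_S1) (\<lambda>(t, \<theta>). nrcdt \<rho> \<mu> t \<theta>)"
proof -
  interpret R: prob_space \<rho> using borel_probD[OF \<rho>] by simp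
  interpret M: prob_space \<mu> using borel_probD[OF \<mu>] by simp
  interpret U: prob_space unif_S1 by (rule prob_space_unif_S1)
  note [measurable_cong] = borel_probD(2)[OF \<mu>]
  have \<mu>': "\<mu>' \<in> borel_prob"
    by (simp add: \<mu>'_def borel_prob_def M.prob_space_distr)
  define \<epsilon> where "\<epsilon> = (sigma_max A - sigma_min A) / sigma_min A"
  note sv = planar_singular_values[OF A]
  have \<epsilon>: "0 \<le> \<epsilon>" "sigma_max A / sigma_min A - 1 = \<epsilon>" "1 \<le> sigma_max A / sigma_min A"
    using sv(1,2) by (simp_all add: \<epsilon>_def field_simps)
  define h where "h \<theta> = sgn (transpose A *v \<theta>)" for \<theta>
  define m where "m = distr unif_S1 S1 h"
  have h: "h \<in> unif_S1 \<rightarrow>\<^sub>M S1"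
    using A direction_map_measurable[of "transpose A"]
    by (simp add: h_def[abs_def] invertible_det_nz measurable_cong_sets[OF sets_unif_S1 refl])
  have det: "sigma_min A * sigma_max A = \<bar>det (transpose A)\<bar>"
    using sv(3) by simp
  note distortion = direction_map_distortion[OF sv(1,2) det sv(4,5),
      folded h_def, folded m_def]
  have bound: "AE t in \<rho>. (mean_nrcdt \<rho> \<mu>' t - mean_nrcdt \<rho> \<mu> t)\<^sup>2
      \<le> \<epsilon>\<^sup>2 * (\<integral>\<theta>. (nrcdt \<rho> \<mu> t \<theta>)\<^sup>2 \<partial>unif_S1)"
    using AE_nrcdt_slice[OF \<rho> \<mu>] nrcdt_affine[OF \<rho> atomless \<mu> A, of y, folded \<mu>'_def, folded h_def]
  proof eventually_elim
    fix t
    assume slice: "integrable unif_S1 (nrcdt \<rho> \<mu> t) \<and>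
      (\<integral>\<theta>. \<bar>nrcdt \<rho> \<mu> t \<theta>\<bar> \<partial>unif_S1)\<^sup>2 \<le> (\<integral>\<theta>. (nrcdt \<rho> \<mu> t \<theta>)\<^sup>2 \<partial>unif_S1)"
      and eq: "\<forall>\<theta>\<in>sphere 0 1. nrcdt \<rho> \<mu>' t \<theta> = nrcdt \<rho> \<mu> t (h \<theta>)"
    have N: "nrcdt \<rho> \<mu> t \<in> borel_measurable S1"
      using slice borel_measurable_integrable[of unif_S1 "nrcdt \<rho> \<mu> t"]
      by (simp add: measurable_cong_sets[OF sets_unif_S1 refl])
    have "mean_nrcdt \<rho> \<mu>' t = (\<integral>\<theta>. nrcdt \<rho> \<mu> t (h \<theta>) \<partial>unif_S1)"
      unfolding mean_nrcdt_def using eq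
      by (intro Bochner_Integration.integral_cong) (auto simp: space_unif_S1)
    also have "\<dots> = (\<integral>\<theta>. nrcdt \<rho> \<mu> t \<theta> \<partial>m)"
      unfolding m_def by (rule integral_distr[symmetric, OF h N])
    finally have "\<bar>mean_nrcdt \<rho> \<mu>' t - mean_nrcdt \<rho> \<mu> t\<bar>
        \<le> \<epsilon> * (\<integral>\<theta>. \<bar>nrcdt \<rho> \<mu> t \<theta>\<bar> \<partial>unif_S1)"
      using integral_comparable_measures[OF _ \<epsilon>(3) distortion, of "nrcdt \<rho> \<mu> t"] slice
      by (simp add: mean_nrcdt_def \<epsilon>(2) m_def sets_unif_S1)
    then have "\<bar>mean_nrcdt \<rho> \<mu>' t - mean_nrcdt \<rho> \<mu> t\<bar>\<^sup>2
        \<le> (\<epsilon> * (\<integral>\<theta>. \<bar>nrcdt \<rho> \<mu> t \<theta>\<bar> \<partial>unif_S1))\<^sup>2"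
      by (rule power_mono) simp
    also have "\<dots> \<le> \<epsilon>\<^sup>2 * (\<integral>\<theta>. (nrcdt \<rho> \<mu> t \<theta>)\<^sup>2 \<partial>unif_S1)"
      using slice by (simp add: power_mult_distrib mult_left_mono)
    finally show "(mean_nrcdt \<rho> \<mu>' t - mean_nrcdt \<rho> \<mu> t)\<^sup>2
        \<le> \<epsilon>\<^sup>2 * (\<integral>\<theta>. (nrcdt \<rho> \<mu> t \<theta>)\<^sup>2 \<partial>unif_S1)"
      by simp
  qed
  have "(L2_norm \<rho> (\<lambda>t. mean_nrcdt \<rho> \<mu>' t - mean_nrcdt \<rho> \<mu> t))\<^sup>2
      \<le> (\<integral>t. \<epsilon>\<^sup>2 * (\<integral>\<theta>. (nrcdt \<rho> \<mu> t \<theta>)\<^sup>2 \<partial>unif_S1) \<partial>\<rho>)"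
    unfolding L2_norm_square
  proof (rule integral_mono_AE[OF _ _ bound])
    show "integrable \<rho> (\<lambda>t. (mean_nrcdt \<rho> \<mu>' t - mean_nrcdt \<rho> \<mu> t)\<^sup>2)"
      using L2_space_diff[OF mean_nrcdt_L2[OF \<rho> \<mu>'] mean_nrcdt_L2[OF \<rho> \<mu>]]
      by (simp add: L2_space_def)
    show "integrable \<rho> (\<lambda>t. \<epsilon>\<^sup>2 * (\<integral>\<theta>. (nrcdt \<rho> \<mu> t \<theta>)\<^sup>2 \<partial>unif_S1))"
      by (intro integrable_mult_right integrable_slice_square \<rho> \<mu>)
  qed
  also have "\<dots> = (\<epsilon> * L2_norm (\<rho> \<Otimes>\<^sub>M unif_S1) (\<lambda>(t, \<theta>). nrcdt \<rho> \<mu> t \<theta>))\<^sup>2"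
    by (simp only: integral_mult_right_zero integrable_slice_square(2)[OF \<rho> \<mu>] power_mult_distrib)
  finally show ?thesis
    unfolding \<epsilon>_def[symmetric]
    by (rule power2_le_imp_le) (simp add: \<epsilon>(1) L2_norm_nonneg)
qed

text \<open>The case \<open>K = 0\<close>, where \<open>\<delta> / K = 0\<close>, is included: the normalized transform of \<open>\<mu>\<close> has norm zero then.\<close>

lemma affine_class_distance:
  assumes \<rho>: "\<rho> \<in> borel_prob" and atomless: "\<forall>t. emeasure \<rho> {t} = 0"
    and \<mu>: "\<mu> \<in> borel_prob" and \<nu>: "\<nu> \<in> affine_class X \<mu>"
    and X: "\<And>A. A \<in> X \<Longrightarrow> invertible A"
    and \<delta>: "\<And>A. A \<in> X \<Longrightarrow> (sigma_max A - sigma_min A) / sigma_min A \<le> \<delta> / K"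
    and K: "L2_norm (\<rho> \<Otimes>\<^sub>M unif_S1) (\<lambda>(t, \<theta>). nrcdt \<rho> \<mu> t \<theta>) \<le> K" and "0 \<le> \<delta>"
  shows "L2_norm \<rho> (\<lambda>t. mean_nrcdt \<rho> \<nu> t - mean_nrcdt \<rho> \<mu> t) \<le> \<delta>"
proof -
  let ?n = "L2_norm (\<rho> \<Otimes>\<^sub>M unif_S1) (\<lambda>(t, \<theta>). nrcdt \<rho> \<mu> t \<theta>)"
  obtain A y where A: "A \<in> X" and \<nu>_eq: "\<nu> = distr \<mu> borel (\<lambda>x. A *v x + y)"
    using \<nu> by (auto simp: affine_class_def)
  have "L2_norm \<rho> (\<lambda>t. mean_nrcdt \<rho> \<nu> t - mean_nrcdt \<rho> \<mu> t)
      \<le> (sigma_max A - sigma_min A) / sigma_min A * ?n"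
    unfolding \<nu>_eq by (rule mean_nrcdt_affine_distance[OF \<rho> atomless \<mu> X[OF A]])
  also have "\<dots> \<le> \<delta> / K * ?n"
    using \<delta>[OF A] by (intro mult_right_mono L2_norm_nonneg)
  also have "\<dots> \<le> \<delta>"
  proof (cases "K = 0")
    case False
    then have "0 < K" using K L2_norm_nonneg[of "\<rho> \<Otimes>\<^sub>M unif_S1" "\<lambda>(t, \<theta>). nrcdt \<rho> \<mu> t \<theta>"] by linarith
    then show ?thesis
      using mult_left_mono[OF K \<open>0 \<le> \<delta>\<close>] by (simp add: pos_divide_le_eq)
  qed (simp add: \<open>0 \<le> \<delta>\<close>)
  finally show ?thesis .
qed

theorem theorem4p11:
  fixes \<rho> :: "real measure"
    and \<mu>\<^sub>0 \<nu>\<^sub>0 :: "(real^2) measure"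
    and c :: real
    and X :: "(real^2^2) set"
    and F\<^sub>0 G\<^sub>0 :: "(real^2) measure set"
  assumes "\<rho> \<in> borel_prob2"
    and "\<forall>t. emeasure \<rho> {t} = 0"
    and "\<mu>\<^sub>0 \<in> borel_prob2_star"
    and "\<nu>\<^sub>0 \<in> borel_prob2_star"
    and "\<not> (AE t in \<rho>. mean_nrcdt \<rho> \<mu>\<^sub>0 t = mean_nrcdt \<rho> \<nu>\<^sub>0 t)"
    and "0 < c" and "c < 1 / 2"
    and "X = {A. invertible A \<and>
      (sigma_max A - sigma_min A) / sigma_min A
        \<le> c * L2_norm \<rho> (\<lambda>t. mean_nrcdt \<rho> \<mu>\<^sub>0 t - mean_nrcdt \<rho> \<nu>\<^sub>0 t)
          / max (L2_norm (\<rho> \<Otimes>\<^sub>M unif_S1) (\<lambda>(t, \<theta>). nrcdt \<rho> \<mu>\<^sub>0 t \<theta>))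
                (L2_norm (\<rho> \<Otimes>\<^sub>M unif_S1) (\<lambda>(t, \<theta>). nrcdt \<rho> \<nu>\<^sub>0 t \<theta>))}"
    and "F\<^sub>0 \<subseteq> affine_class X \<mu>\<^sub>0" and "F\<^sub>0 \<noteq> {}"
    and "G\<^sub>0 \<subseteq> affine_class X \<nu>\<^sub>0" and "G\<^sub>0 \<noteq> {}"
  shows "\<exists>\<Phi> b. continuous_linear_functional_L2 \<rho> \<Phi> \<and>
    (\<forall>\<mu>\<in>F\<^sub>0. \<forall>\<nu>\<in>G\<^sub>0. \<Phi> (mean_nrcdt \<rho> \<mu>) < b \<and> b < \<Phi> (mean_nrcdt \<rho> \<nu>))"
proof -
  note X_def = assms(8)
  have \<rho>: "\<rho> \<in> borel_prob" and \<mu>\<^sub>0: "\<mu>\<^sub>0 \<in> borel_prob" and \<nu>\<^sub>0: "\<nu>\<^sub>0 \<in> borel_prob"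
    using assms(1,3,4) by (auto simp: borel_prob2_def borel_prob2_star_def)
  have prob_class: "\<mu> \<in> borel_prob" if "\<mu> \<in> affine_class X \<mu>'" for \<mu> \<mu>'
    using that by (simp add: affine_class_def)
  define m where "m = mean_nrcdt \<rho> \<mu>\<^sub>0"
  define n where "n = mean_nrcdt \<rho> \<nu>\<^sub>0"
  define D where "D = L2_norm \<rho> (\<lambda>t. m t - n t)"
  define g where "g t = n t - m t" for t
  \<comment> \<open>The inner product with the difference of the transforms of the two templates.\<close>
  define \<Phi> where "\<Phi> f = (\<integral>t. f t * g t \<partial>\<rho>)" for f
  have m: "m \<in> L2_space \<rho>" and n: "n \<in> L2_space \<rho>"
    unfolding m_def n_def by (intro mean_nrcdt_L2 \<rho> \<mu>\<^sub>0 \<nu>\<^sub>0)+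
  have g: "g \<in> L2_space \<rho>"
    using L2_space_diff[OF n m] by (simp add: g_def[abs_def])
  have norm_g: "L2_norm \<rho> g = D"
    by (simp add: D_def L2_norm_def g_def power2_commute)
  have "D \<noteq> 0"
  proof
    assume "D = 0"
    then have "(\<integral>t. (m t - n t)\<^sup>2 \<partial>\<rho>) = 0" by (simp add: D_def L2_norm_def)
    moreover have "integrable \<rho> (\<lambda>t. (m t - n t)\<^sup>2)"
      using L2_space_diff[OF m n] by (simp add: L2_space_def)
    ultimately have "AE t in \<rho>. (m t - n t)\<^sup>2 = 0"
      by (simp add: integral_nonneg_eq_0_iff_AE)
    then show False using assms(5) by (simp add: m_def n_def)
  qed
  then have D: "0 < D" using L2_norm_nonneg[of \<rho> "\<lambda>t. m t - n t"] by (simp add: D_def)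
  have dist: "\<bar>\<Phi> (mean_nrcdt \<rho> \<kappa>) - \<Phi> (mean_nrcdt \<rho> \<kappa>\<^sub>0)\<bar> \<le> c * D * D"
    if "\<kappa>\<^sub>0 = \<mu>\<^sub>0 \<or> \<kappa>\<^sub>0 = \<nu>\<^sub>0" "\<kappa> \<in> affine_class X \<kappa>\<^sub>0" for \<kappa> \<kappa>\<^sub>0
  proof -
    have \<kappa>: "\<kappa> \<in> borel_prob" "\<kappa>\<^sub>0 \<in> borel_prob" using that \<mu>\<^sub>0 \<nu>\<^sub>0 prob_class by auto
    then have L2: "mean_nrcdt \<rho> \<kappa> \<in> L2_space \<rho>" "mean_nrcdt \<rho> \<kappa>\<^sub>0 \<in> L2_space \<rho>"
      by (auto intro: mean_nrcdt_L2 \<rho>)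
    have close: "L2_norm \<rho> (\<lambda>t. mean_nrcdt \<rho> \<kappa> t - mean_nrcdt \<rho> \<kappa>\<^sub>0 t) \<le> c * D"
    proof (rule affine_class_distance[OF \<rho> assms(2) \<kappa>(2) that(2)])
      show "invertible A" if "A \<in> X" for A using that X_def by simp
      show "(sigma_max A - sigma_min A) / sigma_min A \<le> c * D /
        max (L2_norm (\<rho> \<Otimes>\<^sub>M unif_S1) (\<lambda>(t, \<theta>). nrcdt \<rho> \<mu>\<^sub>0 t \<theta>))
            (L2_norm (\<rho> \<Otimes>\<^sub>M unif_S1) (\<lambda>(t, \<theta>). nrcdt \<rho> \<nu>\<^sub>0 t \<theta>))" if "A \<in> X" for A
        using that X_def by (simp add: D_def m_def n_def)
    qed (use that(1) assms(6) D in auto)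
    have "\<Phi> (mean_nrcdt \<rho> \<kappa>) - \<Phi> (mean_nrcdt \<rho> \<kappa>\<^sub>0)
        = (\<integral>t. (mean_nrcdt \<rho> \<kappa> t - mean_nrcdt \<rho> \<kappa>\<^sub>0 t) * g t \<partial>\<rho>)"
      using L2_mult_integrable[OF L2(1) g] L2_mult_integrable[OF L2(2) g]
      by (simp add: \<Phi>_def left_diff_distrib)
    then have "\<bar>\<Phi> (mean_nrcdt \<rho> \<kappa>) - \<Phi> (mean_nrcdt \<rho> \<kappa>\<^sub>0)\<bar>
        \<le> L2_norm \<rho> (\<lambda>t. mean_nrcdt \<rho> \<kappa> t - mean_nrcdt \<rho> \<kappa>\<^sub>0 t) * D"
      using L2_Cauchy_Schwarz[OF L2_space_diff[OF L2] g] by (simp add: norm_g)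
    also have "\<dots> \<le> c * D * D"
      using close D by (intro mult_right_mono) auto
    finally show ?thesis .
  qed
  have gap: "\<Phi> n - \<Phi> m = D * D"
  proof -
    have "\<Phi> n - \<Phi> m = (\<integral>t. n t * g t - m t * g t \<partial>\<rho>)"
      unfolding \<Phi>_def using L2_mult_integrable[OF n g] L2_mult_integrable[OF m g] by simp
    also have "\<dots> = (\<integral>t. (g t)\<^sup>2 \<partial>\<rho>)"
      by (simp add: g_def power2_eq_square algebra_simps)
    also have "\<dots> = D * D"
      using L2_norm_square[of \<rho> g] by (simp only: norm_g power2_eq_square)
    finally show ?thesis .
  qed
  have "c * D * D < D * D / 2"
    using assms(7) D mult_strict_right_mono[of c "1 / 2" "D * D"] by simp
  then have "\<Phi> (mean_nrcdt \<rho> \<mu>) < \<Phi> m + D * D / 2 \<and> \<Phi> m + D * D / 2 < \<Phi> (mean_nrcdt \<rho> \<nu>)"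
    if "\<mu> \<in> F\<^sub>0" "\<nu> \<in> G\<^sub>0" for \<mu> \<nu>
    using dist[of \<mu>\<^sub>0 \<mu>] dist[of \<nu>\<^sub>0 \<nu>] that assms(9,11) gap
    by (auto simp: m_def n_def abs_le_iff subset_iff)
  moreover have "continuous_linear_functional_L2 \<rho> \<Phi>"
    unfolding \<Phi>_def[abs_def] by (rule continuous_linear_functional_L2_inner[OF g])
  ultimately show ?thesis by blast
qed

end
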